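(* Consider, for $d\ge 1$, the control system $$\dot z=e^{-\gamma(z)}u+v,\qquad z,u,v\in\mathbb{R}^d,\qquad \gamma(z)=\tfrac12(z_1^2+\cdots+z_d^2),$$ with controls $(u(t),v(t))$ taking values in $\mathbb{R}^d\times\mathbb{R}^d$. i) If $d>1$, the system is ensemble controllable on $\mathbb{R}^d$; that is: (a) for each $N\ge 1$, each $T>0$ and any two $N$-tuples $(x^1_\alpha,\ldots,x^N_\alpha)$, $(x^1_\omega,\ldots,x^N_\omega)$ of pairwise distinct points of $\mathbb{R}^d$, there is a control $(u(t),v(t))$, $t\in[0,T]$, such that for each $k=1,\ldots,N$ the trajectory starting at $x^k_\alpha$ at time $0$ is at $x^k_\omega$ at time $T$; (b) for each $\hat P\in\mathrm{Diff}^c_0(\mathbb{R}^d)$, each compact $K\subset\mathbb{R}^d$ and each $\varepsilon>0$ there is a control on $[0,T]$ such that the corresponding flow satisfies $\sup_{x\in K}|\hat P(x)-P_T(x)|<\varepsilon$. ii) If $d=1$, the system is approximately controllable in $\mathrm{Diff}^c_0(\mathbb{R})$, i.e. the statement (b) holds on $\mathbb{R}$. iii) If $d=1$, the system can transform a finite ensemble $(x^1_\alpha,\ldots,x^N_\alpha)$ of pairwise distinct points of $\mathbb{R}$ into another finite ensemble $(x^1_\omega,\ldots,x^N_\omega)$ of pairwise distinct points (i.e. there is a control on an interval $[0,T]$ whose trajectory from $x^k_\alpha$ ends at $x^k_\omega$ for every $k$) if and only if the ensembles are equally ordered: $x^i_\alpha<x^j_\alpha\Leftrightarrow x^i_\omega<x^j_\omega$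 for all $i,j$.
   Context: $\mathrm{Diff}^c_0(\mathbb{R}^d)$ is the connected component of the identity in the group of compactly supported smooth diffeomorphisms of $\mathbb{R}^d$. Controls are integrable functions of $t$. The flow $P_t$ corresponding to a control maps $x$ to the value at time $t$ of the solution starting at $x$ at time $0$. The length $T>0$ of the time interval is irrelevant: since the right-hand side is linear in the control, rescaling time and control replaces $T$ by any $T'>0$. *)

theory Defs
  imports "HOL-Analysis.Analysis"
begin

section \<open>Compactly supported diffeomorphisms and the identity component\<close>

text \<open>
  Iterated directional derivative: \<open>iter_deriv [b\<^sub>1, \<dots>, b\<^sub>k] f\<close> differentiates first along \<open>b\<^sub>1\<close> and
  last along \<open>b\<^sub>k\<close>; for basis vectors these are the iterated partial derivatives.
\<close>

fun iter_deriv :: "'a list \<Rightarrow> ('a::real_normed_vector \<Rightarrow> 'b::real_normed_vector) \<Rightarrow> 'a \<Rightarrow> 'b" where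
  "iter_deriv [] f = f"
| "iter_deriv (b # bs) f = iter_deriv bs (\<lambda>x. frechet_derivative f (at x) b)"

text \<open>
  Class C-infinity: all iterated partial derivatives exist and are (Frechet) differentiable
  everywhere; in particular they are all continuous. The junk values of
  \<^const>\<open>frechet_derivative\<close> play no role, because every prefix of a basis list is a basis list.
\<close>

definition smooth_map :: "('a::euclidean_space \<Rightarrow> 'b::real_normed_vector) \<Rightarrow> bool" where
  "smooth_map f \<longleftrightarrow> (\<forall>bs \<in> lists Basis. \<forall>x. iter_deriv bs f differentiable (at x))"

definition diffeo :: "('a::euclidean_space \<Rightarrow> 'a) \<Rightarrow> bool" where
  "diffeo f \<longleftrightarrow> bij f \<and> smooth_map f \<and> smooth_map (inv f)"

definition diffeo_support :: "('a::euclidean_space \<Rightarrow> 'a) \<Rightarrow> 'a set" where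
  "diffeo_support f = closure {x. f x \<noteq> x}"

definition Diff_on :: "'a set \<Rightarrow> ('a::euclidean_space \<Rightarrow> 'a) set" where
  "Diff_on K = {f. diffeo f \<and> diffeo_support f \<subseteq> K}"

definition Diffc :: "('a::euclidean_space \<Rightarrow> 'a) set" where
  "Diffc = {f. diffeo f \<and> compact (diffeo_support f)}"

definition Cr_ball :: "'a set \<Rightarrow> nat \<Rightarrow> real \<Rightarrow> ('a::euclidean_space \<Rightarrow> 'a) \<Rightarrow> ('a \<Rightarrow> 'a) set" where
  "Cr_ball K r \<epsilon> f = {g \<in> Diff_on K.
     \<forall>bs \<in> lists Basis. length bs \<le> r \<longrightarrow>
       (\<forall>x. norm (iter_deriv bs g x - iter_deriv bs f x) < \<epsilon>)}"

text \<open>The C-infinity topology: uniform convergence of all derivatives.\<close>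

definition Diff_on_topology :: "'a set \<Rightarrow> ('a::euclidean_space \<Rightarrow> 'a) topology" where
  "Diff_on_topology K =
     topology (\<lambda>U. U \<subseteq> Diff_on K \<and> (\<forall>f\<in>U. \<exists>r. \<exists>\<epsilon>>0. Cr_ball K r \<epsilon> f \<subseteq> U))"

text \<open>
  The group of compactly supported diffeomorphisms carries the direct limit topology of the
  groups \<open>Diff_on K\<close> with \<open>K\<close> compact. The topology of C-infinity convergence on compact sets
  would be too coarse: it does not control supports and has a larger identity component.
\<close>

definition Diffc_topology :: "('a::euclidean_space \<Rightarrow> 'a) topology" where
  "Diffc_topology =
     topology (\<lambda>U. U \<subseteq> Diffc \<and>
       (\<forall>K. compact K \<longrightarrow> openin (Diff_on_topology K) (U \<inter> Diff_on K)))"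

definition Diffc0 :: "('a::euclidean_space \<Rightarrow> 'a) set" where
  "Diffc0 = connected_component_of_set Diffc_topology id"

lemma Cr_ball_mono:
  assumes "r \<le> r'" "\<epsilon>' \<le> \<epsilon>"
  shows "Cr_ball K r' \<epsilon>' f \<subseteq> Cr_ball K r \<epsilon> f"
proof
  fix g assume g: "g \<in> Cr_ball K r' \<epsilon>' f"
  have "norm (iter_deriv bs g x - iter_deriv bs f x) < \<epsilon>"
    if "bs \<in> lists Basis" "length bs \<le> r" for bs x
  proof -
    have "norm (iter_deriv bs g x - iter_deriv bs f x) < \<epsilon>'"
      using g that order_trans[OF that(2) assms(1)] unfolding Cr_ball_def by blast
    then show ?thesis using assms(2) by simp
  qed
  then show "g \<in> Cr_ball K r \<epsilon> f"
    using g unfolding Cr_ball_def by blast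
qed

lemma openin_Diff_on_topology:
  "openin (Diff_on_topology K) (U :: ('a::euclidean_space \<Rightarrow> 'a) set) \<longleftrightarrow>
     U \<subseteq> Diff_on K \<and> (\<forall>f\<in>U. \<exists>r. \<exists>\<epsilon>>0. Cr_ball K r \<epsilon> f \<subseteq> U)"
proof -
  let ?P = "\<lambda>U. U \<subseteq> Diff_on K \<and> (\<forall>f\<in>U. \<exists>r. \<exists>\<epsilon>>0. Cr_ball K r \<epsilon> f \<subseteq> U)"
  have "istopology ?P"
    unfolding istopology_def
  proof (intro conjI allI impI)
    fix S T :: "('a \<Rightarrow> 'a) set" assume S: "?P S" and T: "?P T"
    show "S \<inter> T \<subseteq> Diff_on K" using S by blast
    show "\<forall>f\<in>S \<inter> T. \<exists>r. \<exists>\<epsilon>>0. Cr_ball K r \<epsilon> f \<subseteq> S \<inter> T"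
    proof
      fix f assume "f \<in> S \<inter> T"
      then obtain r1 e1 r2 e2 where
        1: "e1 > 0" "Cr_ball K r1 e1 f \<subseteq> S" and 2: "e2 > 0" "Cr_ball K r2 e2 f \<subseteq> T"
        using S T by fast
      have "Cr_ball K (max r1 r2) (min e1 e2) f \<subseteq> S \<inter> T"
        using 1(2) 2(2) Cr_ball_mono[of r1 "max r1 r2" "min e1 e2" e1 K f]
          Cr_ball_mono[of r2 "max r1 r2" "min e1 e2" e2 K f] by auto
      moreover have "min e1 e2 > 0" using 1 2 by simp
      ultimately show "\<exists>r. \<exists>\<epsilon>>0. Cr_ball K r \<epsilon> f \<subseteq> S \<inter> T" by blast
    qed
  next
    fix \<K> assume A: "\<forall>U\<in>\<K>. ?P U"
    show "\<Union>\<K> \<subseteq> Diff_on K" using A by blast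
    show "\<forall>f\<in>\<Union>\<K>. \<exists>r. \<exists>\<epsilon>>0. Cr_ball K r \<epsilon> f \<subseteq> \<Union>\<K>"
    proof
      fix f assume "f \<in> \<Union>\<K>"
      then obtain U where U: "U \<in> \<K>" "f \<in> U" by blast
      then obtain r e where "e > 0" "Cr_ball K r e f \<subseteq> U" using A by meson
      with U show "\<exists>r. \<exists>\<epsilon>>0. Cr_ball K r \<epsilon> f \<subseteq> \<Union>\<K>" by blast
    qed
  qed
  then show ?thesis
    unfolding Diff_on_topology_def by (subst topology_inverse') (assumption, rule refl)
qed

lemma openin_Diffc_topology:
  "openin Diffc_topology (U :: ('a::euclidean_space \<Rightarrow> 'a) set) \<longleftrightarrow>
     U \<subseteq> Diffc \<and> (\<forall>K. compact K \<longrightarrow> openin (Diff_on_topology K) (U \<inter> Diff_on K))"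
proof -
  let ?P = "\<lambda>U :: ('a \<Rightarrow> 'a) set. U \<subseteq> Diffc \<and> (\<forall>K. compact K \<longrightarrow> openin (Diff_on_topology K) (U \<inter> Diff_on K))"
  have "istopology ?P"
    unfolding istopology_def
  proof (intro conjI allI impI)
    fix S T :: "('a \<Rightarrow> 'a) set" and K assume S: "?P S" and T: "?P T"
    show "S \<inter> T \<subseteq> Diffc" using S by blast
    assume "compact (K :: 'a set)"
    then have "openin (Diff_on_topology K) (S \<inter> Diff_on K)"
      and "openin (Diff_on_topology K) (T \<inter> Diff_on K)"
      using S T by simp_all
    then have "openin (Diff_on_topology K) ((S \<inter> Diff_on K) \<inter> (T \<inter> Diff_on K))"
      by (rule openin_Int)
    moreover have "(S \<inter> Diff_on K) \<inter> (T \<inter> Diff_on K) = S \<inter> T \<inter> Diff_on K"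
      by blast
    ultimately show "openin (Diff_on_topology K) (S \<inter> T \<inter> Diff_on K)"
      by simp
  next
    fix \<K> :: "('a \<Rightarrow> 'a) set set" and K assume A: "\<forall>U\<in>\<K>. ?P U"
    show "\<Union>\<K> \<subseteq> Diffc" using A by blast
    assume "compact (K :: 'a set)"
    then have "openin (Diff_on_topology K) (U \<inter> Diff_on K)" if "U \<in> \<K>" for U
      using A that by simp
    then have "openin (Diff_on_topology K) (\<Union> ((\<lambda>U. U \<inter> Diff_on K) ` \<K>))"
      by blast
    moreover have "\<Union> ((\<lambda>U. U \<inter> Diff_on K) ` \<K>) = \<Union>\<K> \<inter> Diff_on K"
      by blast
    ultimately show "openin (Diff_on_topology K) (\<Union>\<K> \<inter> Diff_on K)"
      by simp
  qed
  then show ?thesis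
    unfolding Diffc_topology_def by (subst topology_inverse') (assumption, rule refl)
qed

lemma openin_Diff_on_topology_Diff_on [simp]: "openin (Diff_on_topology K) (Diff_on K)"
proof -
  have "Cr_ball K 0 1 f \<subseteq> Diff_on K" for f
    by (auto simp: Cr_ball_def)
  then show ?thesis
    unfolding openin_Diff_on_topology by (meson order_refl zero_less_one)
qed

lemma Diff_on_subset_Diffc:
  assumes "compact K"
  shows "Diff_on K \<subseteq> Diffc"
proof
  fix f assume "f \<in> Diff_on K"
  then have f: "diffeo f" "diffeo_support f \<subseteq> K"
    by (simp_all add: Diff_on_def)
  have "closed (diffeo_support f)"
    by (simp add: diffeo_support_def)
  then have "compact (K \<inter> diffeo_support f)"
    using assms by (intro compact_Int_closed)
  then show "f \<in> Diffc"
    using f by (simp add: Diffc_def Int_absorb1)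
qed

lemma topspace_Diffc_topology [simp]: "topspace Diffc_topology = Diffc"
proof (rule antisym)
  show "topspace Diffc_topology \<subseteq> Diffc"
    using openin_topspace[of Diffc_topology] unfolding openin_Diffc_topology by (rule conjunct1)
  have "openin Diffc_topology Diffc"
    unfolding openin_Diffc_topology
    by (simp add: Diff_on_subset_Diffc Int_absorb1)
  then show "Diffc \<subseteq> topspace Diffc_topology"
    by (rule openin_subset)
qed

lemma iter_deriv_const: "iter_deriv bs (\<lambda>x. c) differentiable (at x)"
  by (induction bs arbitrary: c) (auto)

lemma id_in_Diffc0: "id \<in> Diffc0"
proof -
  have "iter_deriv bs (id :: 'a \<Rightarrow> 'a) differentiable (at x)" for bs and x :: 'a
    by (cases bs) (auto simp: iter_deriv_const id_def)
  then have "smooth_map (id :: 'a \<Rightarrow> 'a)"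
    by (simp add: smooth_map_def)
  then have "(id :: 'a \<Rightarrow> 'a) \<in> Diffc"
    by (simp add: Diffc_def diffeo_def diffeo_support_def)
  then show ?thesis
    unfolding Diffc0_def by (simp add: connected_component_of_refl)
qed

section \<open>The control system\<close>

definition gam :: "'a::euclidean_space \<Rightarrow> real" where
  "gam z = (1/2) * (\<Sum>b\<in>Basis. (z \<bullet> b)\<^sup>2)"

definition rhs :: "'a::euclidean_space \<Rightarrow> 'a \<Rightarrow> 'a \<Rightarrow> 'a" where
  "rhs z u v = exp (- gam z) *\<^sub>R u + v"

definition is_control :: "real \<Rightarrow> (real \<Rightarrow> 'a::euclidean_space) \<Rightarrow> (real \<Rightarrow> 'a) \<Rightarrow> bool" where
  "is_control T u v \<longleftrightarrow> u absolutely_integrable_on {0..T} \<and> v absolutely_integrable_on {0..T}"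

text \<open>Solutions are Caratheodory solutions, since controls are merely integrable.\<close>

definition trajectory ::
  "real \<Rightarrow> (real \<Rightarrow> 'a::euclidean_space) \<Rightarrow> (real \<Rightarrow> 'a) \<Rightarrow> 'a \<Rightarrow> (real \<Rightarrow> 'a) \<Rightarrow> bool" where
  "trajectory T u v x z \<longleftrightarrow>
     continuous_on {0..T} z \<and>
     (\<forall>t\<in>{0..T}. ((\<lambda>s. rhs (z s) (u s) (v s)) has_integral (z t - x)) {0..t})"

definition is_flow ::
  "real \<Rightarrow> (real \<Rightarrow> 'a::euclidean_space) \<Rightarrow> (real \<Rightarrow> 'a) \<Rightarrow> (real \<Rightarrow> 'a \<Rightarrow> 'a) \<Rightarrow> bool" where
  "is_flow T u v P \<longleftrightarrow> (\<forall>x. trajectory T u v x (\<lambda>t. P t x))"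

definition ensemble_steerable ::
  "real \<Rightarrow> nat \<Rightarrow> (nat \<Rightarrow> 'a::euclidean_space) \<Rightarrow> (nat \<Rightarrow> 'a) \<Rightarrow> bool" where
  "ensemble_steerable T N x\<^sub>\<alpha> x\<^sub>\<omega> \<longleftrightarrow>
     (\<exists>u v. is_control T u v \<and>
        (\<forall>k\<in>{1..N}. \<exists>z. trajectory T u v (x\<^sub>\<alpha> k) z \<and> z T = x\<^sub>\<omega> k))"

text \<open>
  The supremum is taken in the extended reals, so that it is meaningful without a prior
  boundedness argument and behaves correctly for \<open>K = {}\<close>.
\<close>

definition flow_approximable ::
  "real \<Rightarrow> 'a::euclidean_space set \<Rightarrow> real \<Rightarrow> ('a \<Rightarrow> 'a) \<Rightarrow> bool" where
  "flow_approximable T K \<epsilon> Q \<longleftrightarrow>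
     (\<exists>u v P. is_control T u v \<and> is_flow T u v P \<and>
        (SUP x\<in>K. ereal (norm (Q x - P T x))) < ereal \<epsilon>)"

end

theory Submission imports Defs begin

text \<open>
  The flows of the system include all translations, hence, after conjugation, the flows of the
  fields \<open>exp (- \<gamma>(x - c)) u\<close> for all \<open>c\<close> and \<open>u\<close>. By Stone--Weierstrass, sums of such fields are
  dense in the continuous fields on any compact set.

  For approximation, the set of maps in \<^const>\<open>Diffc\<close> that are locally uniform limits of flows
  is open and closed, so it contains \<^const>\<open>Diffc0\<close>. This reduces to maps \<open>id + D\<close>
  with \<open>D\<close> a contraction, for which the isotopy \<open>id + t D\<close> is followed by Euler steps, each of
  them approximated by short cycles through finitely many Gaussians.

  For ensembles, Gaussians interpolating at the given points make the endpoint map of a finite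
  product of steps a small Lipschitz perturbation of a translation of the ensemble, so a fixed
  point argument gives exact steering between all ensembles near a given one, and connectedness
  of the configuration space (in dimension one: convexity of the ordered configurations)
  globalizes this.
\<close>

section \<open>The Gaussian\<close>

text \<open>Steering uses only constant controls with \<open>u = 0\<close> or \<open>v = 0\<close>
  and their concatenations, so the flows come from a scalar separable equation; general integrable
  controls occur only in the no-crossing argument. Two obstacles shape the estimates. A better
  approximation of a field by Gaussians comes with uncontrolled coefficients, so the splitting error
  of a cycle through them has no a priori bound. Hence the Gaussians are fixed before the number of
  cycles, and stability is always drawn from the Lipschitz constant of the target field. Further,
  closedness of the set of approximable maps requires passing from a varying nearby map back to a
  fixed one, hence a uniform bound on the inverses of the nearby maps; C^1 closeness supplies it. In
  exact steering the Gaussians interpolate only approximately, but an approximate inverse of the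
  linearized endpoint map is enough for a contraction. There the dimension enters only through
  connectedness of the complement of a finite set.\<close>

abbreviation gauss :: "'a::euclidean_space \<Rightarrow> real" where
  "gauss z \<equiv> exp (- gam z)"

lemma gam_eq: "gam z = (z \<bullet> z) / 2"
  unfolding gam_def by (subst euclidean_inner[of z z]) (simp add: power2_eq_square)

lemma gam_nonneg [simp]: "0 \<le> gam z"
  by (simp add: gam_eq)

lemma gauss_le_1: "gauss z \<le> 1"
  by simp

text \<open>Mean value bound: the derivative is at most 1 in modulus because \<open>\<bar>z\<bar>
  \<le> 1 + z\<^sup>2 / 2 \<le> exp (z\<^sup>2 / 2)\<close>.\<close>

lemma exp_neg_half_square_lipschitz:
  fixes r s :: real
  shows "\<bar>exp (- (r\<^sup>2 / 2)) - exp (- (s\<^sup>2 / 2))\<bar> \<le> \<bar>r - s\<bar>"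
proof -
  have "norm (exp (- (r\<^sup>2 / 2)) - exp (- (s\<^sup>2 / 2))) \<le> 1 * norm (r - s)"
  proof (rule field_differentiable_bound[of UNIV])
    show "((\<lambda>r. exp (- (r\<^sup>2 / 2))) has_field_derivative - z * exp (- (z\<^sup>2 / 2))) (at z within UNIV)"
      for z :: real
      by (auto intro!: derivative_eq_intros)
    show "norm (- z * exp (- (z\<^sup>2 / 2))) \<le> 1" for z :: real
    proof -
      have "0 \<le> (\<bar>z\<bar> - 1)\<^sup>2" by simp
      then have "\<bar>z\<bar> \<le> 1 + z\<^sup>2 / 2" by (simp add: power2_eq_square algebra_simps)
      also have "\<dots> \<le> exp (z\<^sup>2 / 2)" by simp
      finally show ?thesis by (simp add: abs_mult exp_minus field_simps)
    qed
  qed auto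
  then show ?thesis by simp
qed

lemma gauss_lipschitz:
  fixes x y :: "'a::euclidean_space"
  shows "\<bar>gauss x - gauss y\<bar> \<le> norm (x - y)"
proof -
  have "gauss x = exp (- ((norm x)\<^sup>2 / 2))" for x :: 'a
    by (simp add: gam_eq power2_norm_eq_inner)
  then have "\<bar>gauss x - gauss y\<bar> \<le> \<bar>norm x - norm y\<bar>"
    using exp_neg_half_square_lipschitz by presburger
  then show ?thesis
    using norm_triangle_ineq3[of x y] by linarith
qed

section \<open>Reparametrization and concatenation of controls\<close>

lemma has_integral_rescale:
  fixes f :: "real \<Rightarrow> 'a::real_normed_vector"
  assumes "(f has_integral i) {0..c * t}" "c > 0"
  shows "((\<lambda>s. c *\<^sub>R f (c * s)) has_integral i) {0..t}"
proof -
  have "(\<lambda>x. x / c) ` {0..c * t} = {0..t}"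
    using assms(2) by (simp add: image_divide_atLeastAtMost)
  then have "((\<lambda>x. f (c * x)) has_integral (1 / c) *\<^sub>R i) {0..t}"
    using has_integral_stretch_real[OF assms(1), of c] assms(2) by simp
  then show ?thesis
    using has_integral_cmul[of "\<lambda>x. f (c * x)" "(1 / c) *\<^sub>R i" "{0..t}" c] assms(2) by simp
qed

lemma absolutely_integrable_rescale:
  fixes f :: "real \<Rightarrow> 'a::euclidean_space"
  assumes "f absolutely_integrable_on {0..c * t}" "c > 0"
  shows "(\<lambda>s. c *\<^sub>R f (c * s)) absolutely_integrable_on {0..t}"
proof (rule absolutely_integrable_onI)
  show "(\<lambda>s. c *\<^sub>R f (c * s)) integrable_on {0..t}"
    using assms has_integral_rescale unfolding absolutely_integrable_on_def integrable_on_def by blast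
  obtain i where "((\<lambda>x. norm (f x)) has_integral i) {0..c * t}"
    using assms unfolding absolutely_integrable_on_def integrable_on_def by blast
  from has_integral_rescale[OF this assms(2)]
  show "(\<lambda>s. norm (c *\<^sub>R f (c * s))) integrable_on {0..t}"
    using assms(2) by (auto simp: integrable_on_def)
qed

lemma rhs_scale: "rhs z (c *\<^sub>R u) (c *\<^sub>R v) = c *\<^sub>R rhs z u v"
  by (simp add: rhs_def algebra_simps)

text \<open>The right-hand side is linear in the control, so the factor \<open>c\<close> produced by
  the change of time is absorbed into \<open>u\<close> and \<open>v\<close>.\<close>

lemma trajectory_rescale:
  assumes "trajectory (c * T) u v x z" "c > 0"
  shows "trajectory T (\<lambda>t. c *\<^sub>R u (c * t)) (\<lambda>t. c *\<^sub>R v (c * t)) x (\<lambda>t. z (c * t))"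
  unfolding trajectory_def
proof (intro conjI ballI)
  have mem: "c * t \<in> {0..c * T}" if "t \<in> {0..T}" for t
    using that assms(2) by auto
  show "continuous_on {0..T} (\<lambda>t. z (c * t))"
    using assms(1) mem unfolding trajectory_def
    by (auto intro!: continuous_on_compose2[of "{0..c*T}" z] continuous_intros)
  fix t assume "t \<in> {0..T}"
  then have "((\<lambda>s. rhs (z s) (u s) (v s)) has_integral (z (c * t) - x)) {0..c * t}"
    using assms(1) mem unfolding trajectory_def by blast
  from has_integral_rescale[OF this assms(2)]
  show "((\<lambda>s. rhs (z (c * s)) (c *\<^sub>R u (c * s)) (c *\<^sub>R v (c * s))) has_integral z (c * t) - x) {0..t}"
    by (simp add: rhs_scale)
qed

lemma trajectory_0:
  assumes "trajectory T u v x z" "T \<ge> 0"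
  shows "z 0 = x"
proof -
  have "(0::real) \<in> {0..T}" using assms(2) by simp
  then have "((\<lambda>s. rhs (z s) (u s) (v s)) has_integral (z 0 - x)) {0..0}"
    using assms(1) unfolding trajectory_def by blast
  then have "z 0 - x = 0"
    using has_integral_refl(2) has_integral_unique by (metis atLeastAtMost_singleton)
  then show ?thesis by simp
qed

text \<open>Used for controls and for trajectories alike. The choice at \<open>t = T\<close> does
  not affect integrals, and for trajectories both pieces agree there.\<close>

definition append_control :: "real \<Rightarrow> (real \<Rightarrow> 'a) \<Rightarrow> (real \<Rightarrow> 'a) \<Rightarrow> real \<Rightarrow> 'a" where
  "append_control T f g t = (if t \<le> T then f t else g (t - T))"

lemma has_integral_append_control:
  fixes f g :: "real \<Rightarrow> 'a::banach"
  assumes "(f has_integral i) {0..T}" "(g has_integral j) {0..S}" "T \<ge> 0" "S \<ge> 0"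
  shows "(append_control T f g has_integral i + j) {0..T + S}"
proof (rule has_integral_combine)
  show "(append_control T f g has_integral i) {0..T}"
    by (rule has_integral_eq[OF _ assms(1)]) (auto simp: append_control_def)
  have "((\<lambda>t. g (t - T)) has_integral j) {T..T + S}"
    using has_integral_shift_real_ivl[OF assms(2), of "- T"] by (simp add: add.commute)
  then show "(append_control T f g has_integral j) {T..T + S}"
    by (rule has_integral_spike_finite[of "{T}", rotated 2]) (auto simp: append_control_def)
qed (use assms in auto)

lemma absolutely_integrable_append_control:
  fixes f g :: "real \<Rightarrow> 'a::euclidean_space"
  assumes "f absolutely_integrable_on {0..T}" "g absolutely_integrable_on {0..S}" "T \<ge> 0" "S \<ge> 0"
  shows "append_control T f g absolutely_integrable_on {0..T + S}"
proof (rule absolutely_integrable_onI)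
  have "(\<lambda>t. norm (append_control T f g t)) = append_control T (\<lambda>t. norm (f t)) (\<lambda>t. norm (g t))"
    by (auto simp: append_control_def)
  then show "(\<lambda>t. norm (append_control T f g t)) integrable_on {0..T + S}"
    using assms has_integral_append_control unfolding absolutely_integrable_on_def integrable_on_def
    by metis
  show "append_control T f g integrable_on {0..T + S}"
    using assms has_integral_append_control unfolding absolutely_integrable_on_def integrable_on_def
    by blast
qed

lemma trajectory_append:
  assumes z: "trajectory T u v x z" and w: "trajectory S u' v' (z T) w" and "T \<ge> 0" "S \<ge> 0"
  shows "trajectory (T + S) (append_control T u u') (append_control T v v') x (append_control T z w)"
  unfolding trajectory_def
proof (intro conjI ballI)
  let ?z = "append_control T z w" and ?u = "append_control T u u'" and ?v = "append_control T v v'"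
  have w0: "w 0 = z T" using w \<open>S \<ge> 0\<close> by (rule trajectory_0)
  have "continuous_on ({0..T} \<union> {T..T + S}) (\<lambda>t. if t \<le> T then z t else w (t - T))"
  proof (rule continuous_on_cases)
    show "continuous_on {T..T + S} (\<lambda>t. w (t - T))"
      using w unfolding trajectory_def
      by (auto intro!: continuous_on_compose2[of "{0..S}" w] continuous_intros)
  qed (use z w0 in \<open>auto simp: trajectory_def\<close>)
  moreover have "{0..T} \<union> {T..T + S} = {0..T + S}"
    using assms(3,4) by auto
  ultimately show "continuous_on {0..T + S} ?z"
    by (simp add: append_control_def[abs_def])
  fix t assume t: "t \<in> {0..T + S}"
  have eq: "(\<lambda>s. rhs (?z s) (?u s) (?v s))
      = append_control T (\<lambda>s. rhs (z s) (u s) (v s)) (\<lambda>s. rhs (w s) (u' s) (v' s))"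
    by (auto simp: append_control_def)
  show "((\<lambda>s. rhs (?z s) (?u s) (?v s)) has_integral ?z t - x) {0..t}"
  proof (cases "t \<le> T")
    case True
    then have "((\<lambda>s. rhs (z s) (u s) (v s)) has_integral z t - x) {0..t}"
      using z t unfolding trajectory_def by auto
    then have "((\<lambda>s. rhs (?z s) (?u s) (?v s)) has_integral z t - x) {0..t}"
      by (rule has_integral_eq[rotated]) (use True in \<open>auto simp: append_control_def\<close>)
    then show ?thesis using True by (simp add: append_control_def)
  next
    case False
    have 1: "((\<lambda>s. rhs (z s) (u s) (v s)) has_integral z T - x) {0..T}"
      using z assms(3) unfolding trajectory_def by auto
    have "t - T \<in> {0..S}" using t False by auto
    then have 2: "((\<lambda>s. rhs (w s) (u' s) (v' s)) has_integral w (t - T) - z T) {0..t - T}"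
      using w unfolding trajectory_def by blast
    have "((\<lambda>s. rhs (?z s) (?u s) (?v s)) has_integral (z T - x + (w (t - T) - z T))) {0..T + (t - T)}"
      unfolding eq by (rule has_integral_append_control[OF 1 2]) (use False assms(3) in auto)
    then show ?thesis using False by (simp add: append_control_def)
  qed
qed

section \<open>Reachable maps\<close>

text \<open>Time 1 stands for every positive time, by rescaling. A solution is required from every
  initial point, so that reachable maps can be composed.\<close>

definition reachable :: "('a::euclidean_space \<Rightarrow> 'a) \<Rightarrow> bool" where
  "reachable f \<longleftrightarrow> (\<exists>u v P. is_control 1 u v \<and> is_flow 1 u v P \<and> P 1 = f)"

lemma reachable_rescale:
  assumes "is_control T u v" "is_flow T u v P" "T > 0" "T' > 0"
  shows "\<exists>u v P'. is_control T' u v \<and> is_flow T' u v P' \<and> P' T' = P T"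
proof (intro exI conjI)
  define c where "c = T / T'"
  have c: "c > 0" "c * T' = T" using assms by (auto simp: c_def)
  show "is_control T' (\<lambda>t. c *\<^sub>R u (c * t)) (\<lambda>t. c *\<^sub>R v (c * t))"
    using assms(1) c by (auto simp: is_control_def intro!: absolutely_integrable_rescale)
  show "is_flow T' (\<lambda>t. c *\<^sub>R u (c * t)) (\<lambda>t. c *\<^sub>R v (c * t)) (\<lambda>t. P (c * t))"
    using assms(2) c by (auto simp: is_flow_def intro!: trajectory_rescale)
  show "P (c * T') = P T" using c by simp
qed

lemma reachableI:
  assumes "is_control T u v" "is_flow T u v P" "T > 0"
  shows "reachable (P T)"
  using reachable_rescale[OF assms, of 1] by (simp add: reachable_def)

lemma reachableD:
  assumes "reachable f" "T > 0"
  shows "\<exists>u v P. is_control T u v \<and> is_flow T u v P \<and> P T = f"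
  using assms reachable_rescale[of 1 _ _ _ T] unfolding reachable_def by fastforce

lemma reachable_comp:
  assumes "reachable f" "reachable g"
  shows "reachable (\<lambda>x. g (f x))"
proof -
  obtain u v P u' v' P' where
    f: "is_control 1 u v" "is_flow 1 u v P" "P 1 = f" and
    g: "is_control 1 u' v'" "is_flow 1 u' v' P'" "P' 1 = g"
    using assms unfolding reachable_def by blast
  define Q where "Q t x = append_control 1 (\<lambda>t. P t x) (\<lambda>t. P' t (P 1 x)) t" for t x
  have "is_control (1 + 1) (append_control 1 u u') (append_control 1 v v')"
    using f(1) g(1) unfolding is_control_def
    by (blast intro: absolutely_integrable_append_control[OF _ _ zero_le_one zero_le_one])
  moreover have "is_flow (1 + 1) (append_control 1 u u') (append_control 1 v v') Q"
    using f(2) g(2) unfolding is_flow_def Q_def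
    by (blast intro: trajectory_append[OF _ _ zero_le_one zero_le_one])
  ultimately have "reachable (Q (1 + 1))" by (rule reachableI) simp
  moreover have "Q (1 + 1) = (\<lambda>x. g (f x))"
    using f(3) g(3) by (auto simp: Q_def append_control_def)
  ultimately show ?thesis by simp
qed

lemma reachable_translation: "reachable (\<lambda>x. x + a)"
  unfolding reachable_def
proof (intro exI conjI)
  show "is_control 1 (\<lambda>t. 0) (\<lambda>t. a)"
    by (auto simp: is_control_def absolutely_integrable_on_def)
  show "is_flow 1 (\<lambda>t. 0) (\<lambda>t. a) (\<lambda>t x. x + t *\<^sub>R a)"
    unfolding is_flow_def trajectory_def rhs_def
  proof (intro allI conjI ballI)
    fix x and t :: real assume "t \<in> {0..1}"
    then show "((\<lambda>s. gauss (x + s *\<^sub>R a) *\<^sub>R 0 + a) has_integral (x + t *\<^sub>R a - x)) {0..t}"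
      using has_integral_const_real[of a 0 t] by simp
  qed (intro continuous_intros)
qed simp

lemma reachable_id: "reachable (\<lambda>x. x)"
  using reachable_translation[of 0] by simp

text \<open>Under constant \<open>u\<close> the motion stays on the line
  \<open>x + s *\<^sub>R u\<close>, and \<open>\<theta>' = gauss (x + \<theta> *\<^sub>R u)\<close>
  is solved by separation of variables: \<open>\<theta>\<close> inverts the antiderivative
  \<open>G\<close> of \<open>1 / gauss\<close>. Since the integrand is at least 1, \<open>G\<close>
  expands distances and its inverse is 1-Lipschitz.\<close>

lemma gaussian_trajectory_exists:
  fixes x u :: "'a::euclidean_space"
  shows "\<exists>z. trajectory 1 (\<lambda>t. u) (\<lambda>t. 0) x z"
proof -
  define f where "f s = exp (gam (x + s *\<^sub>R u))" for s
  \<comment> \<open>The interval \<open>{-2..2}\<close> has the times 0 and 1 in its interior, so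
    two-sided derivatives are available on all of \<open>{0..1}\<close>.\<close>
  have f: "continuous_on {-2..2} f"
    unfolding f_def gam_eq by (intro continuous_intros) auto
  have f1: "f s \<ge> 1" for s by (simp add: f_def gam_eq)
  obtain G0 where G0: "\<And>s. s \<in> {-2..2} \<Longrightarrow> (G0 has_vector_derivative f s) (at s within {-2..2})"
    using antiderivative_continuous[OF f] by blast
  define G where "G s = G0 s - G0 0" for s
  have G: "(G has_real_derivative f s) (at s within {-2..2})" if "s \<in> {-2..2}" for s
    unfolding G_def has_real_derivative_iff_has_vector_derivative
    using G0[OF that] by (auto intro!: derivative_eq_intros)
  have Gat: "(G has_real_derivative f s) (at s)" if "s \<in> {-2<..<2}" for s
    using G[of s] that at_within_Icc_at[of "-2" s 2] by auto
  have cG: "continuous_on {-2..2} G"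
    using G by (meson DERIV_continuous_on)
  have grow: "s' - s \<le> G s' - G s" if "-2 \<le> s" "s \<le> s'" "s' \<le> 2" for s s'
  proof (cases "s = s'")
    case False
    then have lt: "s < s'" using that by simp
    have "continuous_on {s..s'} G" using cG that by (meson atLeastatMost_subset_iff continuous_on_subset)
    moreover have "G differentiable (at r)" if "s < r" "r < s'" for r
      using Gat[of r] that \<open>-2 \<le> s\<close> \<open>s' \<le> 2\<close> by (auto simp: real_differentiable_def)
    ultimately obtain l r where r: "s < r" "r < s'" "(G has_real_derivative l) (at r)"
      and eq: "G s' - G s = (s' - s) * l"
      using MVT[OF lt, of G] by blast
    have "l = f r" using Gat[of r] that r DERIV_unique by auto
    then show ?thesis using f1[of r] lt eq by simp
  qed simp
  have G00: "G 0 = 0" by (simp add: G_def)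
  have inj: "inj_on G {-2..2}"
  proof (rule linorder_inj_onI)
    show "G s \<noteq> G s'" if "s < s'" "s \<in> {-2..2}" "s' \<in> {-2..2}" for s s'
      using grow[of s s'] that by auto
  qed auto
  define \<theta> where "\<theta> = inv_into {-2..2} G"
  \<comment> \<open>As \<open>G\<close> vanishes at 0 and expands, it maps \<open>{-2..2}\<close>
    onto a set containing \<open>{-2..2}\<close>.\<close>
  have surj: "\<exists>s\<in>{-2..2}. G s = y" if "-2 \<le> y" "y \<le> 2" for y
    using IVT'[of G "-2" y 2] grow[of "-2" 0] grow[of 0 2] G00 that cG by force
  have \<theta>: "\<theta> y \<in> {-2..2}" "G (\<theta> y) = y" if "-2 \<le> y" "y \<le> 2" for y
    using surj[OF that] inv_into_into[of y G "{-2..2}"] f_inv_into_f[of y G "{-2..2}"]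
    unfolding \<theta>_def by blast+
  have \<theta>0: "\<theta> 0 = 0" using G00 inj unfolding \<theta>_def by (metis atLeastAtMost_iff inv_into_f_f neg_le_0_iff_le zero_le_numeral)
  have lip: "\<bar>\<theta> y - \<theta> y'\<bar> \<le> \<bar>y - y'\<bar>" if "-2 \<le> y" "y \<le> 2" "-2 \<le> y'" "y' \<le> 2" for y y'
    using grow[of "\<theta> y" "\<theta> y'"] grow[of "\<theta> y'" "\<theta> y"] \<theta>[of y] \<theta>[of y'] that
    by (cases "\<theta> y \<le> \<theta> y'") auto
  have der: "(\<theta> has_real_derivative gauss (x + \<theta> y *\<^sub>R u)) (at y)" if "-2 < y" "y < 2" for y
  proof -
    have "(\<theta> has_real_derivative inverse (f (\<theta> y))) (at y)"
    proof (rule DERIV_inverse_function[of G _ _ _ "-2" 2])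
      have "\<bar>\<theta> y\<bar> < 2" using lip[of y 0] \<theta>0 that by auto
      then show "(G has_real_derivative f (\<theta> y)) (at (\<theta> y))" by (intro Gat) auto
      show "f (\<theta> y) \<noteq> 0" using f1[of "\<theta> y"] by linarith
      have "continuous_on {-2..2} \<theta>"
        by (rule continuous_on_iff[THEN iffD2]) (metis lip atLeastAtMost_iff dist_real_def order_le_less_trans)
      then show "isCont \<theta> y" using that by (intro continuous_on_interior[of "{-2..2}"]) auto
    qed (use \<theta> that in auto)
    then show ?thesis by (simp add: f_def exp_minus)
  qed
  have "trajectory 1 (\<lambda>t. u) (\<lambda>t. 0) x (\<lambda>t. x + \<theta> t *\<^sub>R u)"
    unfolding trajectory_def
  proof (intro conjI ballI)
    have c\<theta>: "continuous_on {0..1} \<theta>"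
      by (auto intro!: continuous_at_imp_continuous_on DERIV_isCont der)
    then show "continuous_on {0..1} (\<lambda>t. x + \<theta> t *\<^sub>R u)"
      by (intro continuous_intros)
    fix t :: real assume t: "t \<in> {0..1}"
    have "((\<lambda>s. gauss (x + \<theta> s *\<^sub>R u) *\<^sub>R u) has_integral ((x + \<theta> t *\<^sub>R u) - (x + \<theta> 0 *\<^sub>R u))) {0..t}"
    proof (rule fundamental_theorem_of_calculus)
      fix s assume "s \<in> {0..t}"
      then have "(\<theta> has_real_derivative gauss (x + \<theta> s *\<^sub>R u)) (at s within {0..t})"
        using t der by (auto intro: has_field_derivative_at_within)
      then show "((\<lambda>s. x + \<theta> s *\<^sub>R u) has_vector_derivative gauss (x + \<theta> s *\<^sub>R u) *\<^sub>R u) (at s within {0..t})"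
        by (auto intro!: derivative_eq_intros)
    qed (use t in auto)
    then show "((\<lambda>s. rhs (x + \<theta> s *\<^sub>R u) u 0) has_integral (x + \<theta> t *\<^sub>R u - x)) {0..t}"
      by (simp add: rhs_def \<theta>0)
  qed
  then show ?thesis by blast
qed

section \<open>Steps along a single Gaussian\<close>

text \<open>An arbitrary solution is selected; all its properties are drawn from the integral
  equation.\<close>

definition gstep0 :: "'a::euclidean_space \<Rightarrow> real \<Rightarrow> 'a \<Rightarrow> 'a" where
  "gstep0 u t x = (SOME z. trajectory 1 (\<lambda>t. u) (\<lambda>t. 0) x z) t"

text \<open>Conjugation by a translation moves the centre of the Gaussian to
  \<open>c\<close>.\<close>

definition gstep :: "'a::euclidean_space \<Rightarrow> 'a \<Rightarrow> 'a \<Rightarrow> 'a" where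
  "gstep c u x = c + gstep0 u 1 (x - c)"

lemma trajectory_gstep0: "trajectory 1 (\<lambda>t. u) (\<lambda>t. 0) x (\<lambda>t. gstep0 u t x)"
  unfolding gstep0_def by (rule someI_ex[OF gaussian_trajectory_exists])

lemma gstep0_has_integral:
  assumes "t \<in> {0..1}"
  shows "((\<lambda>s. gauss (gstep0 u s x) *\<^sub>R u) has_integral (gstep0 u t x - x)) {0..t}"
  using trajectory_gstep0[of u x] assms by (auto simp: trajectory_def rhs_def)

lemma reachable_gstep: "reachable (gstep c u)"
proof -
  have "is_control 1 (\<lambda>t. u) (\<lambda>t. 0)"
    by (auto simp: is_control_def absolutely_integrable_on_def)
  moreover have "is_flow 1 (\<lambda>t. u) (\<lambda>t. 0) (gstep0 u)"
    using trajectory_gstep0 by (auto simp: is_flow_def)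
  ultimately have "reachable (gstep0 u 1)" by (rule reachableI) simp
  from reachable_comp[OF reachable_comp[OF reachable_translation[of "-c"] this] reachable_translation[of c]]
  show ?thesis by (simp add: gstep_def[abs_def] add.commute)
qed

lemma has_integral_norm_le_unit:
  fixes f :: "real \<Rightarrow> 'a::real_normed_vector"
  assumes "(f has_integral i) {0..t}" "t \<in> {0..1}" "B \<ge> 0" "\<And>s. s \<in> {0..t} \<Longrightarrow> norm (f s) \<le> B"
  shows "norm i \<le> B"
proof -
  have "norm i \<le> B * measure lborel (cbox 0 t)"
    using assms by (intro has_integral_bound[of B f]) auto
  also have "\<dots> \<le> B * 1" using assms by (intro mult_left_mono) auto
  finally show ?thesis by simp
qed

lemma norm_gstep0_diff_le:
  assumes "t \<in> {0..1}"
  shows "norm (gstep0 u t x - x) \<le> norm u"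
  by (rule has_integral_norm_le_unit[OF gstep0_has_integral[OF assms] assms])
    (auto intro: mult_left_le_one_le simp: gauss_le_1)

text \<open>Freezing the Gaussian at the starting point costs at most the distance travelled,
  \<open>norm u\<close>, times the speed bound \<open>norm u\<close>.\<close>

lemma gstep_approx: "norm (gstep c u x - x - gauss (x - c) *\<^sub>R u) \<le> (norm u)\<^sup>2"
proof -
  define y where "y = x - c"
  have "((\<lambda>s. gauss (gstep0 u s y) *\<^sub>R u - gauss y *\<^sub>R u) has_integral
      (gstep0 u 1 y - y - gauss y *\<^sub>R u)) {0..1}"
    using has_integral_diff[OF gstep0_has_integral[of 1 u y] has_integral_const_real[of "gauss y *\<^sub>R u" 0 1]]
    by simp
  then have "norm (gstep0 u 1 y - y - gauss y *\<^sub>R u) \<le> (norm u)\<^sup>2"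
  proof (rule has_integral_norm_le_unit)
    fix s :: real assume "s \<in> {0..1}"
    then have "\<bar>gauss (gstep0 u s y) - gauss y\<bar> \<le> norm u"
      using gauss_lipschitz norm_gstep0_diff_le order_trans by blast
    then show "norm (gauss (gstep0 u s y) *\<^sub>R u - gauss y *\<^sub>R u) \<le> (norm u)\<^sup>2"
      by (simp add: scaleR_diff_left[symmetric] power2_eq_square mult_right_mono)
  qed auto
  then show ?thesis by (simp add: gstep_def y_def algebra_simps)
qed

lemma gstep_0 [simp]: "gstep c 0 x = x"
  using gstep_approx[of c 0 x] by simp

lemma norm_gstep_diff_le: "norm (gstep c u x - x) \<le> norm u"
  using norm_gstep0_diff_le[of 1 u "x - c"] by (simp add: gstep_def algebra_simps)

lemma norm_gauss_scaleR_diff_le: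
  "norm (gauss z *\<^sub>R u - gauss z' *\<^sub>R u') \<le> norm (u - u') + norm (z - z') * norm u'"
proof -
  have "gauss z *\<^sub>R u - gauss z' *\<^sub>R u' = gauss z *\<^sub>R (u - u') + (gauss z - gauss z') *\<^sub>R u'"
    by (simp add: algebra_simps)
  then have "norm (gauss z *\<^sub>R u - gauss z' *\<^sub>R u')
      \<le> gauss z * norm (u - u') + \<bar>gauss z - gauss z'\<bar> * norm u'"
    by (metis abs_exp_cancel norm_scaleR norm_triangle_ineq)
  also have "\<dots> \<le> norm (u - u') + norm (z - z') * norm u'"
    using gauss_le_1[of z] gauss_lipschitz[of z z']
    by (intro add_mono mult_right_mono mult_left_le_one_le) auto
  finally show ?thesis .
qed

text \<open>Gronwall by absorption: at the time \<open>m\<close> of largest distance, the integral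
  equation bounds \<open>d m\<close> by the data plus \<open>d m / 2\<close>, because
  \<open>norm u' \<le> 1/2\<close>. This gives the factor 2.\<close>

lemma gstep0_dependence:
  fixes x x' u u' :: "'a::euclidean_space"
  assumes u': "norm u' \<le> 1/2" and t: "t \<in> {0..1}"
  shows "norm (gstep0 u t x - gstep0 u' t x') \<le> 2 * (norm (x - x') + norm (u - u'))"
proof -
  define d where "d s = norm (gstep0 u s x - gstep0 u' s x')" for s
  have "continuous_on {0..1} d"
    using trajectory_gstep0[of u x] trajectory_gstep0[of u' x'] unfolding d_def trajectory_def
    by (intro continuous_intros) auto
  then obtain m where m: "m \<in> {0..1}" "\<And>s. s \<in> {0..1} \<Longrightarrow> d s \<le> d m"
    using continuous_attains_sup[of "{0..1}" d] by auto
  have "norm (gstep0 u m x - x - (gstep0 u' m x' - x')) \<le> norm (u - u') + d m * norm u'"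
  proof (rule has_integral_norm_le_unit[OF _ m(1)])
    show "((\<lambda>s. gauss (gstep0 u s x) *\<^sub>R u - gauss (gstep0 u' s x') *\<^sub>R u') has_integral
        gstep0 u m x - x - (gstep0 u' m x' - x')) {0..m}"
      using m(1) by (intro has_integral_diff gstep0_has_integral)
    fix s assume "s \<in> {0..m}"
    then have "d s * norm u' \<le> d m * norm u'" using m by (intro mult_right_mono) auto
    then show "norm (gauss (gstep0 u s x) *\<^sub>R u - gauss (gstep0 u' s x') *\<^sub>R u')
        \<le> norm (u - u') + d m * norm u'"
      using norm_gauss_scaleR_diff_le[of "gstep0 u s x" u "gstep0 u' s x'" u'] by (simp add: d_def)
  qed (simp add: d_def)
  moreover have "d m * norm u' \<le> d m * (1/2)"
    using u' by (intro mult_left_mono) (auto simp: d_def)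
  moreover have "d m \<le> norm (gstep0 u m x - x - (gstep0 u' m x' - x')) + norm (x - x')"
    unfolding d_def using norm_triangle_ineq[of "gstep0 u m x - x - (gstep0 u' m x' - x')" "x - x'"]
    by (simp add: algebra_simps)
  ultimately have "d m \<le> (norm (u - u') + d m * (1/2)) + norm (x - x')"
    by linarith
  then have "d m \<le> 2 * (norm (x - x') + norm (u - u'))" by simp
  then show ?thesis using m(2)[OF t] by (simp add: d_def)
qed

text \<open>Strict differentiability of \<open>(x, u) \<mapsto> gstep c u x\<close> at \<open>(p, 0)\<close>, in quantitative form.\<close>

lemma gstep_strict_diff:
  fixes x x' u u' p :: "'a::euclidean_space"
  assumes u': "norm u' \<le> 1/2"
  shows "norm (gstep c u x - gstep c u' x' - (x - x') - gauss (p - c) *\<^sub>R (u - u'))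
    \<le> (norm (x - p) + norm u) * norm (u - u') + 2 * (norm (x - x') + norm (u - u')) * norm u'"
proof -
  define y y' q where "y = x - c" and "y' = x' - c" and "q = p - c"
  have "norm (gstep0 u 1 y - y - (gstep0 u' 1 y' - y') - gauss q *\<^sub>R (u - u'))
    \<le> (norm (y - q) + norm u) * norm (u - u') + 2 * (norm (y - y') + norm (u - u')) * norm u'"
  proof (rule has_integral_norm_le_unit)
    show "((\<lambda>s. gauss (gstep0 u s y) *\<^sub>R u - gauss (gstep0 u' s y') *\<^sub>R u' - gauss q *\<^sub>R (u - u')) has_integral
        gstep0 u 1 y - y - (gstep0 u' 1 y' - y') - gauss q *\<^sub>R (u - u')) {0..1}"
      using has_integral_const_real[of "gauss q *\<^sub>R (u - u')" 0 1]
      by (intro has_integral_diff gstep0_has_integral) auto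
    fix s :: real assume s: "s \<in> {0..1}"
    let ?z = "gstep0 u s y" and ?z' = "gstep0 u' s y'"
    have "\<bar>gauss ?z - gauss q\<bar> \<le> norm (?z - q)" by (rule gauss_lipschitz)
    also have "\<dots> \<le> norm (y - q) + norm u"
      using norm_gstep0_diff_le[OF s, of u y] norm_triangle_ineq[of "?z - y" "y - q"] by simp
    finally have 1: "\<bar>gauss ?z - gauss q\<bar> \<le> norm (y - q) + norm u" .
    have "\<bar>gauss ?z - gauss ?z'\<bar> \<le> norm (?z - ?z')" by (rule gauss_lipschitz)
    also have "\<dots> \<le> 2 * (norm (y - y') + norm (u - u'))" by (rule gstep0_dependence[OF u' s])
    finally have 2: "\<bar>gauss ?z - gauss ?z'\<bar> \<le> 2 * (norm (y - y') + norm (u - u'))" .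
    \<comment> \<open>The first term measures the Gaussian moving away from its value at
      \<open>q\<close>, the second the separation of the two solutions.\<close>
    have "gauss ?z *\<^sub>R u - gauss ?z' *\<^sub>R u' - gauss q *\<^sub>R (u - u')
      = (gauss ?z - gauss q) *\<^sub>R (u - u') + (gauss ?z - gauss ?z') *\<^sub>R u'"
      by (simp add: algebra_simps)
    then have "norm (gauss ?z *\<^sub>R u - gauss ?z' *\<^sub>R u' - gauss q *\<^sub>R (u - u'))
        \<le> \<bar>gauss ?z - gauss q\<bar> * norm (u - u') + \<bar>gauss ?z - gauss ?z'\<bar> * norm u'"
      by (metis norm_scaleR norm_triangle_ineq)
    also have "\<dots> \<le> (norm (y - q) + norm u) * norm (u - u') + 2 * (norm (y - y') + norm (u - u')) * norm u'"
      using 1 2 by (intro add_mono mult_right_mono) auto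
    finally show "norm (gauss ?z *\<^sub>R u - gauss ?z' *\<^sub>R u' - gauss q *\<^sub>R (u - u')) \<le> \<dots>" .
  qed auto
  then show ?thesis by (simp add: gstep_def y_def y'_def q_def algebra_simps)
qed

section \<open>Sums of Gaussians\<close>

fun gsteps :: "('a::euclidean_space \<times> 'a) list \<Rightarrow> 'a \<Rightarrow> 'a" where
  "gsteps [] x = x"
| "gsteps ((c, u) # l) x = gsteps l (gstep c u x)"

fun gsum :: "('a::euclidean_space \<times> 'a) list \<Rightarrow> 'a \<Rightarrow> 'a" where
  "gsum [] x = 0"
| "gsum ((c, u) # l) x = gauss (x - c) *\<^sub>R u + gsum l x"

definition scale_steps :: "real \<Rightarrow> ('a \<times> 'a::euclidean_space) list \<Rightarrow> ('a \<times> 'a) list" where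
  "scale_steps h l = map (\<lambda>(c, u). (c, h *\<^sub>R u)) l"

lemma reachable_gsteps: "reachable (gsteps l)"
proof (induction l)
  case Nil
  have "gsteps [] = (\<lambda>x. x)" by auto
  then show ?case using reachable_id by simp
next
  case (Cons p l)
  obtain c u where p: "p = (c, u)" by (cases p)
  have "gsteps (p # l) = (\<lambda>x. gsteps l (gstep c u x))" by (auto simp: p)
  then show ?case using reachable_comp[OF reachable_gstep Cons.IH, of c u] by simp
qed

lemma gsum_append: "gsum (l @ l') x = gsum l x + gsum l' x"
  by (induction l) auto

lemma gsum_lipschitz: "\<exists>L\<ge>0. \<forall>x y. norm (gsum l x - gsum l y) \<le> L * norm (x - y)"
proof (induction l)
  case Nil
  show ?case by (intro exI[of _ 0]) auto
next
  case (Cons p l)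
  obtain c u where p: "p = (c, u)" by (cases p)
  obtain L where L: "L \<ge> 0" "\<And>x y. norm (gsum l x - gsum l y) \<le> L * norm (x - y)"
    using Cons.IH by blast
  have "norm (gsum (p # l) x - gsum (p # l) y) \<le> (norm u + L) * norm (x - y)" for x y
  proof -
    have "norm (gsum (p # l) x - gsum (p # l) y)
        \<le> norm (gauss (x - c) *\<^sub>R u - gauss (y - c) *\<^sub>R u) + norm (gsum l x - gsum l y)"
      unfolding p by (simp add: norm_diff_triangle_ineq)
    then show ?thesis
      using norm_gauss_scaleR_diff_le[of "x - c" u "y - c" u] L(2)[of x y] by (simp add: algebra_simps)
  qed
  then show ?case using L(1) by (meson add_nonneg_nonneg norm_ge_zero)
qed

text \<open>Composing short flows agrees with adding their fields to first order. The constant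
  depends on \<open>l\<close> but on neither \<open>h\<close> nor \<open>y\<close>, so the error per
  unit time vanishes as \<open>h\<close> tends to 0.\<close>

lemma gsteps_scale_approx:
  "\<exists>C\<ge>0. \<forall>h\<in>{0..1}. \<forall>y. norm (gsteps (scale_steps h l) y - y - h *\<^sub>R gsum l y) \<le> C * h\<^sup>2"
proof (induction l)
  case Nil
  show ?case by (intro exI[of _ 0]) (auto simp: scale_steps_def)
next
  case (Cons p l)
  obtain c u where p: "p = (c, u)" by (cases p)
  obtain C where C: "C \<ge> 0"
    "\<And>h y. h \<in> {0..1} \<Longrightarrow> norm (gsteps (scale_steps h l) y - y - h *\<^sub>R gsum l y) \<le> C * h\<^sup>2"
    using Cons.IH by blast
  obtain L where L: "L \<ge> 0" "\<And>x y. norm (gsum l x - gsum l y) \<le> L * norm (x - y)"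
    using gsum_lipschitz by blast
  define C' where "C' = C + (norm u)\<^sup>2 + L * norm u"
  have "norm (gsteps (scale_steps h (p # l)) y - y - h *\<^sub>R gsum (p # l) y) \<le> C' * h\<^sup>2"
    if h: "h \<in> {0..1}" for h y
  proof -
    define z where "z = gstep c (h *\<^sub>R u) y"
    have 1: "norm (gsteps (scale_steps h l) z - z - h *\<^sub>R gsum l z) \<le> C * h\<^sup>2" using C h by blast
    have 2: "norm (z - y - gauss (y - c) *\<^sub>R h *\<^sub>R u) \<le> (norm u)\<^sup>2 * h\<^sup>2"
      using gstep_approx[of c "h *\<^sub>R u" y] by (simp add: z_def power_mult_distrib mult.commute)
    have "norm (h *\<^sub>R (gsum l z - gsum l y)) \<le> h * (L * norm (z - y))"
      using L(2)[of z y] h by (simp add: mult_left_mono)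
    also have "\<dots> \<le> h * (L * (h * norm u))"
      using norm_gstep_diff_le[of c "h *\<^sub>R u" y] h L(1) unfolding z_def
      by (intro mult_left_mono) auto
    finally have 3: "norm (h *\<^sub>R (gsum l z - gsum l y)) \<le> L * norm u * h\<^sup>2"
      by (simp add: power2_eq_square algebra_simps)
    \<comment> \<open>Three errors: the remaining steps started at \<open>z\<close>, the first step
      itself, and the remaining field taken at \<open>z\<close> instead of \<open>y\<close>.\<close>
    have "gsteps (scale_steps h (p # l)) y - y - h *\<^sub>R gsum (p # l) y =
      (gsteps (scale_steps h l) z - z - h *\<^sub>R gsum l z) + (z - y - gauss (y - c) *\<^sub>R h *\<^sub>R u)
      + h *\<^sub>R (gsum l z - gsum l y)"
      by (simp add: p scale_steps_def z_def algebra_simps)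
    then have "norm (gsteps (scale_steps h (p # l)) y - y - h *\<^sub>R gsum (p # l) y)
        \<le> C * h\<^sup>2 + (norm u)\<^sup>2 * h\<^sup>2 + L * norm u * h\<^sup>2"
      using 1 2 3 by (smt (verit) norm_triangle_ineq)
    then show ?thesis by (simp add: C'_def algebra_simps)
  qed
  moreover have "C' \<ge> 0" using C L by (simp add: C'_def)
  ultimately show ?case by blast
qed

section \<open>Density of the span of translated Gaussians\<close>

text \<open>
  Since \<open>\<gamma>(x - c) = \<gamma>(x) + \<gamma>(c) - x \<bullet> c\<close>, the span of the translates of the Gaussian is
  \<open>exp (- \<gamma>)\<close> times the algebra spanned by the exponentials \<open>x \<mapsto> exp (x \<bullet> c)\<close>.
\<close>

definition expsum :: "('a::euclidean_space \<times> real) list \<Rightarrow> 'a \<Rightarrow> real" where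
  "expsum l x = (\<Sum>(c, a)\<leftarrow>l. a * exp (x \<bullet> c))"

lemma expsum_dense:
  fixes f :: "'a::euclidean_space \<Rightarrow> real"
  assumes "compact K" "continuous_on K f" "e > 0"
  shows "\<exists>l. \<forall>x\<in>K. \<bar>f x - expsum l x\<bar> < e"
proof -
  have "\<exists>g. g \<in> range expsum \<and> (\<forall>x\<in>K. \<bar>f x - g x\<bar> < e)"
  proof (rule Stone_Weierstrass_HOL[OF assms(1) _ _ _ _ _ assms(2,3)])
    show "(\<lambda>x. c) \<in> range expsum" for c
      by (intro image_eqI[of _ _ "[(0, c)]"]) (auto simp: expsum_def)
    show "continuous_on K g" if "g \<in> range expsum" for g
    proof -
      have "continuous_on K (expsum l)" for l
        unfolding expsum_def by (induction l) (auto intro!: continuous_intros)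
      then show ?thesis using that by blast
    qed
    show "(\<lambda>x. f x + g x) \<in> range expsum" if fg: "f \<in> range expsum \<and> g \<in> range expsum" for f g
    proof -
      obtain l l' where "f = expsum l" "g = expsum l'" using fg by blast
      then have "(\<lambda>x. f x + g x) = expsum (l @ l')" by (simp add: expsum_def[abs_def])
      then show ?thesis by simp
    qed
    show "(\<lambda>x. f x * g x) \<in> range expsum" if fg: "f \<in> range expsum \<and> g \<in> range expsum" for f g
    proof -
      obtain l l' where l: "f = expsum l" "g = expsum l'" using fg by blast
      \<comment> \<open>Closure under products: multiplying exponentials adds their exponents
        \<open>c\<close> and \<open>c'\<close>.\<close>
      have 1: "expsum (map (\<lambda>(c', b). (c + c', a * b)) l') x = a * exp (x \<bullet> c) * expsum l' x" for a c x
        by (induction l') (auto simp: expsum_def exp_add inner_add_right algebra_simps)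
      have "expsum l x * expsum l' x
          = expsum (concat (map (\<lambda>(c, a). map (\<lambda>(c', b). (c + c', a * b)) l') l)) x" for x
      proof (induction l)
        case (Cons p l)
        have "expsum (xs @ ys) x = expsum xs x + expsum ys x" for xs ys
          by (simp add: expsum_def)
        moreover have "expsum (p # l) x = (case p of (c, a) \<Rightarrow> a * exp (x \<bullet> c)) + expsum l x"
          by (simp add: expsum_def)
        ultimately show ?case using Cons.IH 1 by (simp add: algebra_simps split: prod.split)
      qed (simp add: expsum_def)
      then show ?thesis unfolding l by blast
    qed
    fix x y assume xy: "x \<in> K \<and> y \<in> K \<and> x \<noteq> y"
    \<comment> \<open>The points are separated by the single exponential with exponent
      \<open>x - y\<close>.\<close>
    then have "(x - y) \<bullet> (x - y) \<noteq> 0" by simp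
    then have "x \<bullet> (x - y) \<noteq> y \<bullet> (x - y)" by (metis inner_diff_left right_minus_eq)
    then show "\<exists>f. f \<in> range expsum \<and> f x \<noteq> f y"
      by (intro exI[of _ "expsum [(x - y, 1)]"]) (auto simp: expsum_def)
  qed
  then show ?thesis by blast
qed

text \<open>Approximate \<open>exp (gam x) * f x\<close> by exponentials and multiply back by
  \<open>gauss x\<close>, which is at most 1 and so does not enlarge the error. The factor
  \<open>exp (gam c)\<close> goes into the coefficients.\<close>

lemma gauss_sum_dense:
  fixes f :: "'a::euclidean_space \<Rightarrow> real"
  assumes "compact K" "continuous_on K f" "e > 0"
  shows "\<exists>l. \<forall>x\<in>K. \<bar>f x - (\<Sum>(c, a)\<leftarrow>l. a * gauss (x - c))\<bar> < e"
proof -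
  have "continuous_on K (\<lambda>x. exp (gam x) * f x)"
    using assms(2) unfolding gam_eq by (intro continuous_intros) auto
  then obtain l where l: "\<And>x. x \<in> K \<Longrightarrow> \<bar>exp (gam x) * f x - expsum l x\<bar> < e"
    using expsum_dense[OF assms(1) _ assms(3)] by blast
  define l' where "l' = map (\<lambda>(c, a). (c, a * exp (gam c))) l"
  have eq: "(\<Sum>(c, a)\<leftarrow>l'. a * gauss (x - c)) = gauss x * expsum l x" for x
  proof -
    have *: "exp (gam c) * gauss (x - c) = gauss x * exp (x \<bullet> c)" for c
    proof -
      have "gam c - gam (x - c) = - gam x + x \<bullet> c"
        by (simp add: gam_eq algebra_simps inner_commute field_simps)
      then show ?thesis by (simp add: exp_add[symmetric])
    qed
    have "a * exp (gam c) * gauss (x - c) = gauss x * (a * exp (x \<bullet> c))" for a c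
      using *[of c] by (simp add: mult.assoc mult.left_commute)
    then show ?thesis
      unfolding l'_def expsum_def by (induction l) (auto simp: algebra_simps)
  qed
  have "\<bar>f x - (\<Sum>(c, a)\<leftarrow>l'. a * gauss (x - c))\<bar> < e" if "x \<in> K" for x
  proof -
    have "f x - (\<Sum>(c, a)\<leftarrow>l'. a * gauss (x - c)) = gauss x * (exp (gam x) * f x - expsum l x)"
      unfolding eq by (simp add: algebra_simps exp_minus)
    then have "\<bar>f x - (\<Sum>(c, a)\<leftarrow>l'. a * gauss (x - c))\<bar> = gauss x * \<bar>exp (gam x) * f x - expsum l x\<bar>"
      by (simp add: abs_mult)
    also have "\<dots> \<le> \<bar>exp (gam x) * f x - expsum l x\<bar>"
      using gauss_le_1[of x] by (intro mult_left_le_one_le) auto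
    finally show ?thesis using l[OF that] by simp
  qed
  then show ?thesis by blast
qed

lemma gsum_dense:
  fixes f :: "'a::euclidean_space \<Rightarrow> 'a"
  assumes "compact K" "continuous_on K f" "e > 0"
  shows "\<exists>l. \<forall>x\<in>K. norm (f x - gsum l x) < e"
proof -
  have *: "\<exists>l. \<forall>x\<in>K. norm ((\<Sum>b\<in>B. (f x \<bullet> b) *\<^sub>R b) - gsum l x) \<le> (\<Sum>b\<in>B. e')"
    if "e' > 0" "B \<subseteq> Basis" for e' B
    using finite_subset[OF that(2) finite_Basis] that(2)
  proof (induction B)
    case empty
    show ?case by (intro exI[of _ "[]"]) auto
  next
    case (insert b B)
    then obtain l where l: "\<And>x. x \<in> K \<Longrightarrow> norm ((\<Sum>b\<in>B. (f x \<bullet> b) *\<^sub>R b) - gsum l x) \<le> (\<Sum>b\<in>B. e')"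
      by auto
    have "continuous_on K (\<lambda>x. f x \<bullet> b)" "e' > 0"
      using assms(2) \<open>e' > 0\<close> by (auto intro!: continuous_intros)
    then obtain k where k: "\<And>x. x \<in> K \<Longrightarrow> \<bar>f x \<bullet> b - (\<Sum>(c, a)\<leftarrow>k. a * gauss (x - c))\<bar> < e'"
      using gauss_sum_dense[OF assms(1)] by blast
    define k' where "k' = map (\<lambda>(c, a). (c, a *\<^sub>R b)) k"
    have k': "gsum k' x = (\<Sum>(c, a)\<leftarrow>k. a * gauss (x - c)) *\<^sub>R b" for x
      unfolding k'_def by (induction k) (auto simp: algebra_simps)
    have b1: "norm b = 1" using insert.prems by auto
    have "norm ((\<Sum>b\<in>insert b B. (f x \<bullet> b) *\<^sub>R b) - gsum (k' @ l) x) \<le> (\<Sum>b\<in>insert b B. e')"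
      if x: "x \<in> K" for x
    proof -
      define \<alpha> and v where "\<alpha> = f x \<bullet> b - (\<Sum>(c, a)\<leftarrow>k. a * gauss (x - c))"
        and "v = (\<Sum>b\<in>B. (f x \<bullet> b) *\<^sub>R b) - gsum l x"
      have "(\<Sum>b\<in>insert b B. (f x \<bullet> b) *\<^sub>R b) - gsum (k' @ l) x = \<alpha> *\<^sub>R b + v"
        using insert.hyps by (simp add: gsum_append k' \<alpha>_def v_def algebra_simps)
      then have "norm ((\<Sum>b\<in>insert b B. (f x \<bullet> b) *\<^sub>R b) - gsum (k' @ l) x) \<le> \<bar>\<alpha>\<bar> + norm v"
        using norm_triangle_ineq[of "\<alpha> *\<^sub>R b" v] b1 by simp
      also have "\<dots> \<le> e' + (\<Sum>b\<in>B. e')"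
        using k[OF x] l[OF x] unfolding \<alpha>_def v_def by (intro add_mono) auto
      finally show ?thesis using insert.hyps by (simp add: distrib_right)
    qed
    then show ?case by blast
  qed
  \<comment> \<open>The factor 2 turns the non-strict bound of the induction into a strict
    one.\<close>
  define e' where "e' = e / (2 * DIM('a))"
  have e': "e' > 0" using assms(3) by (simp add: e'_def)
  have "(\<Sum>b\<in>(Basis::'a set). e') = e / 2" by (simp add: e'_def)
  with *[OF e' order_refl] obtain l where "\<And>x. x \<in> K \<Longrightarrow> norm (f x - gsum l x) \<le> e / 2"
    unfolding euclidean_representation by metis
  moreover have "e / 2 < e" using assms(3) by simp
  ultimately show ?thesis using le_less_trans by blast
qed

section \<open>Approximable maps\<close>

definition approximable :: "('a::euclidean_space \<Rightarrow> 'a) \<Rightarrow> bool" where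
  "approximable g \<longleftrightarrow> (\<forall>K e. compact K \<and> e > 0 \<longrightarrow> (\<exists>f. reachable f \<and> (\<forall>x\<in>K. norm (g x - f x) < e)))"

lemma approximable_id: "approximable id"
  unfolding approximable_def using reachable_id by fastforce

lemma approximable_comp:
  fixes f g :: "'a::euclidean_space \<Rightarrow> 'a"
  assumes f: "approximable f" "continuous_on UNIV f" and g: "approximable g" "continuous_on UNIV g"
  shows "approximable (g \<circ> f)"
  unfolding approximable_def
proof (intro allI impI, elim conjE)
  fix K :: "'a set" and e :: real assume K: "compact K" and e: "e > 0"
  have cfK: "compact (f ` K)"
    using K f(2) compact_continuous_image continuous_on_subset by blast
  define K' where "K' = {x + y |x y. x \<in> f ` K \<and> y \<in> cball 0 1}"
  have K': "compact K'" unfolding K'_def using cfK compact_cball by (rule compact_sums)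
  have "uniformly_continuous_on K' g"
    using K' g(2) compact_uniformly_continuous continuous_on_subset by blast
  then obtain d where d: "d > 0"
    "\<And>x x'. x \<in> K' \<Longrightarrow> x' \<in> K' \<Longrightarrow> dist x' x < d \<Longrightarrow> dist (g x') (g x) < e / 2"
    unfolding uniformly_continuous_on_def using half_gt_zero[OF e] by meson
  obtain f' where f': "reachable f'" "\<And>x. x \<in> K \<Longrightarrow> norm (f x - f' x) < min d 1"
    using f(1) K d(1) unfolding approximable_def by (metis min_less_iff_conj zero_less_one)
  obtain g' where g': "reachable g'" "\<And>x. x \<in> K' \<Longrightarrow> norm (g x - g' x) < e / 2"
    using g(1) K' half_gt_zero[OF e] unfolding approximable_def by meson
  have "norm ((g \<circ> f) x - g' (f' x)) < e" if x: "x \<in> K" for x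
  proof -
    have "f x = f x + 0" "f' x = f x + (f' x - f x)" by auto
    moreover have "f' x - f x \<in> cball 0 1" using f'(2)[OF x] by (simp add: norm_minus_commute)
    ultimately have in1: "f x \<in> K'" and in2: "f' x \<in> K'"
      unfolding K'_def using x by (blast intro: centre_in_cball[THEN iffD2, OF zero_le_one])+
    have "norm (g (f x) - g (f' x)) < e / 2"
      using d(2)[OF in2 in1] f'(2)[OF x] by (simp add: dist_norm)
    moreover have "norm (g (f' x) - g' (f' x)) < e / 2" using g'(2)[OF in2] .
    ultimately show ?thesis
      using norm_triangle_ineq[of "g (f x) - g (f' x)" "g (f' x) - g' (f' x)"] by simp
  qed
  then show "\<exists>f''. reachable f'' \<and> (\<forall>x\<in>K. norm ((g \<circ> f) x - f'' x) < e)"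
    using reachable_comp[OF f'(1) g'(1)] by blast
qed

lemma reachable_funpow: "reachable f \<Longrightarrow> reachable (f ^^ n)"
proof (induction n)
  case 0
  show ?case using reachable_id by (simp add: id_def)
next
  case (Suc n)
  then show ?case using reachable_comp[OF Suc.IH[OF Suc.prems] Suc.prems] by (simp add: o_def)
qed

text \<open>
  One Euler step of length \<open>s\<close> along \<open>X\<close> is approximated by \<open>n\<close> cycles of length \<open>s / n\<close> through
  the Gaussians of a sum close to \<open>X\<close>; both \<open>n\<close> and the Gaussians depend on \<open>s\<close>, while the
  error bound does not depend on them.
\<close>

lemma euler_step_reachable:
  fixes X :: "'a::euclidean_space \<Rightarrow> 'a"
  assumes lip: "\<And>x y. norm (X x - X y) \<le> norm (x - y)" and bd: "\<And>x. norm (X x) \<le> M"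
    and s: "0 < s" "s \<le> 1"
  shows "\<exists>f. reachable f \<and> (\<forall>y\<in>cball 0 R. norm (f y - y - s *\<^sub>R X y) \<le> (M + 2) * s\<^sup>2)"
proof -
  have M: "M \<ge> 0" using bd[of 0] norm_ge_zero order_trans by blast
  \<comment> \<open>The cycles move a point of \<open>cball 0 R\<close> by at most
    \<open>s * (M + 1) \<le> M + 1\<close>, so approximating \<open>X\<close> on this ball
    suffices.\<close>
  have "continuous_on (cball 0 (R + M + 1)) X"
    unfolding continuous_on_iff dist_norm using lip order_le_less_trans by blast
  then obtain l where l: "\<And>x. x \<in> cball 0 (R + M + 1) \<Longrightarrow> norm (X x - gsum l x) < s / 2"
    using gsum_dense[OF compact_cball _ half_gt_zero[OF s(1)]] by blast
  obtain C where C: "C \<ge> 0"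
    "\<And>h y. h \<in> {0..1} \<Longrightarrow> norm (gsteps (scale_steps h l) y - y - h *\<^sub>R gsum l y) \<le> C * h\<^sup>2"
    using gsteps_scale_approx[of l] by blast
  \<comment> \<open>\<open>n > 2 * C\<close> pushes the splitting error \<open>C * h\<close> below
    \<open>s / 2\<close>, matching the accuracy of the Gaussian sum.\<close>
  obtain n :: nat where n: "n > 2 * C" "n \<ge> 1"
    by (metis of_nat_1 of_nat_le_iff reals_Archimedean2 max.bounded_iff max_less_iff_conj nle_le
        of_nat_max order_less_le_trans)
  define h where "h = s / n"
  have h: "0 < h" "h \<le> 1" "n * h = s" using s n(2) by (auto simp: h_def divide_le_eq)
  have Ch: "C * h \<le> s / 2"
  proof -
    have "C * s \<le> (n / 2) * s" using n(1) s by (intro mult_right_mono) auto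
    then show ?thesis using n(2) by (simp add: h_def field_simps)
  qed
  define B where "B = gsteps (scale_steps h l)"
  have step: "norm (B z - z - h *\<^sub>R X z) \<le> h * s" if "norm z \<le> R + M + 1" for z
  proof -
    have "norm (B z - z - h *\<^sub>R gsum l z) \<le> h * (C * h)"
      using C(2)[of h z] h by (simp add: B_def power2_eq_square algebra_simps)
    also have "\<dots> \<le> h * (s / 2)" using Ch h by (intro mult_left_mono) auto
    finally have 1: "norm (B z - z - h *\<^sub>R gsum l z) \<le> h * (s / 2)" .
    have 2: "norm (h *\<^sub>R (gsum l z - X z)) \<le> h * (s / 2)"
      using l[of z] that h by (simp add: norm_minus_commute mult_left_mono)
    have "B z - z - h *\<^sub>R X z = (B z - z - h *\<^sub>R gsum l z) + h *\<^sub>R (gsum l z - X z)"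
      by (simp add: algebra_simps)
    then have "norm (B z - z - h *\<^sub>R X z) \<le> h * (s / 2) + h * (s / 2)"
      using 1 2 norm_triangle_mono by metis
    then show ?thesis by (simp add: algebra_simps)
  qed
  \<comment> \<open>The first bound keeps the orbit in the ball where \<open>step\<close> applies.
    In \<open>M + 2\<close>, one unit is the error of a cycle, and \<open>M + 1\<close> is the drift
    of \<open>X\<close> along the path, by its Lipschitz bound.\<close>
  have main: "norm ((B ^^ i) y - y) \<le> (i * h) * (M + 1) \<and>
      norm ((B ^^ i) y - y - (i * h) *\<^sub>R X y) \<le> (i * h) * ((M + 2) * s)"
    if y: "norm y \<le> R" and i: "i \<le> n" for y i
    using i
  proof (induction i)
    case (Suc i)
    define z where "z = (B ^^ i) y"
    have ih: "norm (z - y) \<le> (i * h) * (M + 1)" "norm (z - y - (i * h) *\<^sub>R X y) \<le> (i * h) * ((M + 2) * s)"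
      using Suc by (auto simp: z_def)
    have "real i * h \<le> n * h" using Suc.prems h by (intro mult_right_mono) auto
    then have ihs: "real i * h \<le> s" using h by simp
    have zy: "norm (z - y) \<le> s * (M + 1)"
      using ih(1) mult_right_mono[OF ihs, of "M + 1"] M by linarith
    also have "\<dots> \<le> M + 1" using s M by (intro mult_left_le_one_le) auto
    finally have "norm z \<le> R + M + 1"
      using y norm_triangle_ineq[of "z - y" y] by simp
    then have st: "norm (B z - z - h *\<^sub>R X z) \<le> h * s" by (rule step)
    have "norm (B z - z) \<le> h * s + h * norm (X z)"
      using st h norm_triangle_ineq[of "B z - z - h *\<^sub>R X z" "h *\<^sub>R X z"] by simp
    also have "\<dots> \<le> h * 1 + h * M"
      using s h bd[of z] by (intro add_mono mult_left_mono) auto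
    finally have "norm (B z - z) \<le> h * (M + 1)" by (simp add: algebra_simps)
    then have A: "norm (B z - y) \<le> (Suc i * h) * (M + 1)"
      using ih(1) norm_triangle_ineq[of "B z - z" "z - y"] by (simp add: algebra_simps)
    have "norm (h *\<^sub>R (X z - X y)) \<le> h * (s * (M + 1))"
      using lip[of z y] zy h by (simp add: mult_left_mono)
    moreover have "B z - y - (Suc i * h) *\<^sub>R X y =
      (z - y - (i * h) *\<^sub>R X y) + ((B z - z - h *\<^sub>R X z) + h *\<^sub>R (X z - X y))"
      by (simp add: algebra_simps)
    ultimately have "norm (B z - y - (Suc i * h) *\<^sub>R X y)
        \<le> (i * h) * ((M + 2) * s) + (h * s + h * (s * (M + 1)))"
      using ih(2) st by (metis norm_triangle_mono)
    also have "\<dots> = (Suc i * h) * ((M + 2) * s)" by (simp add: algebra_simps)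
    finally show ?case using A by (simp add: z_def)
  qed auto
  show ?thesis
  proof (intro exI conjI ballI)
    show "reachable (B ^^ n)" unfolding B_def by (intro reachable_funpow reachable_gsteps)
    fix y :: 'a assume "y \<in> cball 0 R"
    then show "norm ((B ^^ n) y - y - s *\<^sub>R X y) \<le> (M + 2) * s\<^sup>2"
      using main[of y n] unfolding h(3) by (simp add: power2_eq_square algebra_simps)
  qed
qed

section \<open>Maps close to the identity are approximable\<close>

text \<open>Preimages of \<open>y\<close> are fixed points of the contraction
  \<open>x \<mapsto> y - t *\<^sub>R D x\<close>; the second claim says that the inverse is
  2-Lipschitz.\<close>

lemma id_plus_contraction:
  fixes D :: "'a::euclidean_space \<Rightarrow> 'a"
  assumes lip: "\<And>x y. norm (D x - D y) \<le> norm (x - y) / 2" and t: "0 \<le> t" "t \<le> 1"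
  shows "\<exists>x. x + t *\<^sub>R D x = y"
    and "norm (x - x') \<le> 2 * norm (x + t *\<^sub>R D x - (x' + t *\<^sub>R D x'))"
proof -
  have tD: "norm (t *\<^sub>R D x - t *\<^sub>R D x') \<le> norm (x - x') / 2" for x x'
  proof -
    have "t * norm (D x - D x') \<le> 1 * norm (D x - D x')" using t by (intro mult_right_mono) auto
    then show ?thesis using lip[of x x'] t by (simp flip: scaleR_diff_right)
  qed
  have "\<exists>!x. y - t *\<^sub>R D x = x"
    by (rule banach_fix_type[of "1/2"]) (use tD in \<open>auto simp: dist_norm norm_minus_commute\<close>)
  then show "\<exists>x. x + t *\<^sub>R D x = y" by (metis diff_add_cancel)
  have "x - x' = (x + t *\<^sub>R D x - (x' + t *\<^sub>R D x')) - (t *\<^sub>R D x - t *\<^sub>R D x')" by simp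
  then have "norm (x - x') \<le> norm (x + t *\<^sub>R D x - (x' + t *\<^sub>R D x')) + norm (t *\<^sub>R D x - t *\<^sub>R D x')"
    by (metis norm_triangle_ineq4)
  then show "norm (x - x') \<le> 2 * norm (x + t *\<^sub>R D x - (x' + t *\<^sub>R D x'))"
    using tD[of x x'] by linarith
qed

text \<open>
  \<open>x + t D x\<close> is an isotopy generated by the velocity fields \<open>D \<circ> (id + t D)\<inverse>\<close>, all of them
  1-Lipschitz; for time steps of length \<open>1 / m\<close> the Euler scheme for it is exact.
\<close>

lemma approximable_id_plus:
  fixes D :: "'a::euclidean_space \<Rightarrow> 'a"
  assumes lip: "\<And>x y. norm (D x - D y) \<le> norm (x - y) / 2" and bd: "\<And>x. norm (D x) \<le> M"
  shows "approximable (\<lambda>x. x + D x)"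
  unfolding approximable_def
proof (intro allI impI, elim conjE)
  fix K :: "'a set" and e :: real assume K: "compact K" and e: "e > 0"
  have M: "M \<ge> 0" using bd[of 0] norm_ge_zero order_trans by blast
  obtain r where r: "r > 0" "\<And>x. x \<in> K \<Longrightarrow> norm x \<le> r"
    using compact_imp_bounded[OF K] bounded_pos by blast
  define C where "C = M + 2"
  have C: "C > 0" using M by (simp add: C_def)
  obtain m :: nat where m: "real m > 2 * C" "real m > 2 * C / e"
    by (metis max_less_iff_conj reals_Archimedean2)
  then have m0: "m > 0" using C by (intro Nat.gr0I) auto
  define s where "s = 1 / real m"
  have s: "0 < s" "s \<le> 1" "m * s = 1" using m0 by (auto simp: s_def)
  \<comment> \<open>The growth term \<open>(1 + s) ^ l - 1\<close> will be at most 2, so the total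
    error is at most \<open>2 * C * s\<close>: below 1 to confine the scheme, below \<open>e\<close>
    for the final accuracy.\<close>
  have Cs: "2 * C * s < 1" "2 * C * s < e" using m m0 e by (auto simp: s_def field_simps)
  define g where "g t x = x + t *\<^sub>R D x" for t x
  define X where "X l y = D (SOME x. g (l * s) x = y)" for l :: nat and y
  have ls: "0 \<le> l * s" "l * s \<le> 1" if "l \<le> m" for l :: nat
  proof -
    have "real l * s \<le> m * s" using that s by (intro mult_right_mono) auto
    then show "l * s \<le> 1" using s by simp
  qed (use s in auto)
  have Xg: "X l (g (l * s) x) = D x" if l: "l \<le> m" for l x
  proof -
    have "g (l * s) (SOME x'. g (l * s) x' = g (l * s) x) = g (l * s) x"
      by (rule someI) (rule refl)
    then have "(SOME x'. g (l * s) x' = g (l * s) x) = x"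
      using id_plus_contraction(2)[OF lip ls[OF l], of "SOME x'. g (l * s) x' = g (l * s) x" x]
      unfolding g_def by simp
    then show ?thesis by (simp add: X_def)
  qed
  have Xlip: "norm (X l y - X l y') \<le> norm (y - y')" if l: "l \<le> m" for l y y'
  proof -
    obtain x x' where x: "y = g (l * s) x" "y' = g (l * s) x'"
      using id_plus_contraction(1)[OF lip ls[OF l]] unfolding g_def by metis
    show ?thesis
      unfolding x Xg[OF l] using lip[of x x'] id_plus_contraction(2)[OF lip ls[OF l], of x x']
      by (simp add: g_def)
  qed
  have Xbd: "norm (X l y) \<le> M" for l y unfolding X_def by (rule bd)
  have "\<exists>f. reachable f \<and> (\<forall>y\<in>cball 0 (r + M + 1). norm (f y - y - s *\<^sub>R X l y) \<le> C * s\<^sup>2)" if "l \<le> m" for l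
    unfolding C_def by (rule euler_step_reachable[OF Xlip[OF that] Xbd s(1,2)])
  then obtain f where f: "\<And>l. l \<le> m \<Longrightarrow> reachable (f l)"
    "\<And>l y. l \<le> m \<Longrightarrow> norm y \<le> r + M + 1 \<Longrightarrow> norm (f l y - y - s *\<^sub>R X l y) \<le> C * s\<^sup>2"
    by (metis dist_0_norm mem_cball)
  have exp_bound: "(1 + s) ^ l \<le> 3" if "l \<le> m" for l
  proof -
    have "(1 + s) ^ l \<le> exp s ^ l" using s by (intro power_mono) auto
    also have "\<dots> = exp (l * s)" by (simp add: exp_of_nat_mult)
    also have "\<dots> \<le> exp 1" using ls[OF that] by simp
    finally show ?thesis using exp_le by linarith
  qed
  \<comment> \<open>The bound is the exact solution, zero at \<open>l = 0\<close>, of the discrete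
    Gronwall recursion: multiply by \<open>1 + s\<close>, then add
    \<open>C * s\<^sup>2\<close>.\<close>
  have "\<exists>\<phi>. reachable \<phi> \<and> (\<forall>x\<in>K. norm (\<phi> x - g (l * s) x) \<le> C * s * ((1 + s) ^ l - 1))" if "l \<le> m" for l
    using that
  proof (induction l)
    case 0
    show ?case using reachable_id by (intro exI[of _ "\<lambda>x. x"]) (auto simp: g_def)
  next
    case (Suc l)
    then obtain \<phi> where \<phi>: "reachable \<phi>"
      "\<And>x. x \<in> K \<Longrightarrow> norm (\<phi> x - g (l * s) x) \<le> C * s * ((1 + s) ^ l - 1)" by auto
    have l: "l \<le> m" using Suc.prems by simp
    have "norm (f l (\<phi> x) - g (Suc l * s) x) \<le> C * s * ((1 + s) ^ Suc l - 1)" if x: "x \<in> K" for x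
    proof -
      let ?y = "\<phi> x" and ?x = "g (l * s) x"
      have e0: "norm (?y - ?x) \<le> C * s * ((1 + s) ^ l - 1)" by (rule \<phi>(2)[OF x])
      also have "\<dots> \<le> C * s * 2" using exp_bound[OF l] C s by (intro mult_left_mono) auto
      also have "\<dots> \<le> 1" using Cs by simp
      finally have yx: "norm (?y - ?x) \<le> 1" .
      have "norm ?x \<le> norm x + (l * s) * norm (D x)"
        unfolding g_def using norm_triangle_ineq[of x "(l * s) *\<^sub>R D x"] ls[OF l] by simp
      also have "\<dots> \<le> r + 1 * M"
        using r(2)[OF x] ls[OF l] bd[of x] by (intro add_mono mult_mono) auto
      finally have "norm ?y \<le> r + M + 1" using yx norm_triangle_ineq[of "?y - ?x" ?x] by simp
      then have 1: "norm (f l ?y - ?y - s *\<^sub>R X l ?y) \<le> C * s\<^sup>2" using f(2)[OF l] by blast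
      have 2: "norm (s *\<^sub>R (X l ?y - X l ?x)) \<le> s * norm (?y - ?x)"
        using Xlip[OF l, of ?y ?x] s by (simp add: mult_left_mono)
      have "g (Suc l * s) x = ?x + s *\<^sub>R X l ?x"
        unfolding Xg[OF l] by (simp add: g_def algebra_simps)
      then have "f l ?y - g (Suc l * s) x
          = (f l ?y - ?y - s *\<^sub>R X l ?y) + (s *\<^sub>R (X l ?y - X l ?x) + (?y - ?x))"
        by (simp add: algebra_simps)
      then have "norm (f l ?y - g (Suc l * s) x) \<le> C * s\<^sup>2 + (s * norm (?y - ?x) + norm (?y - ?x))"
        using 1 2 norm_triangle_mono order_refl by metis
      also have "\<dots> = C * s\<^sup>2 + (1 + s) * norm (?y - ?x)" by (simp add: algebra_simps)
      also have "\<dots> \<le> C * s\<^sup>2 + (1 + s) * (C * s * ((1 + s) ^ l - 1))"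
        using e0 s by (intro add_left_mono mult_left_mono) auto
      also have "\<dots> = C * s * ((1 + s) ^ Suc l - 1)"
        by (simp add: power2_eq_square algebra_simps)
      finally show ?thesis .
    qed
    then show ?case using reachable_comp[OF \<phi>(1) f(1)[OF l]] by blast
  qed
  from this[OF order_refl] obtain \<phi> where \<phi>: "reachable \<phi>"
    "\<And>x. x \<in> K \<Longrightarrow> norm (\<phi> x - g 1 x) \<le> C * s * ((1 + s) ^ m - 1)" using s(3) by auto
  have "norm (x + D x - \<phi> x) < e" if "x \<in> K" for x
  proof -
    have "C * s * ((1 + s) ^ m - 1) \<le> C * s * 2"
      using exp_bound[of m] C s by (intro mult_left_mono) auto
    then have "norm (\<phi> x - g 1 x) \<le> C * s * 2" using \<phi>(2)[OF that] by linarith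
    then show ?thesis using Cs by (simp add: g_def norm_minus_commute algebra_simps)
  qed
  then show "\<exists>f. reachable f \<and> (\<forall>x\<in>K. norm (x + D x - f x) < e)" using \<phi>(1) by blast
qed

section \<open>The identity component\<close>

text \<open>Turns the bounds on partial derivatives that define \<open>Cr_ball\<close> into
  Lipschitz constants.\<close>

lemma lipschitz_of_partials:
  fixes f :: "'a::euclidean_space \<Rightarrow> 'b::real_normed_vector"
  assumes der: "\<And>x. (f has_derivative f' x) (at x)"
    and bd: "\<And>x b. b \<in> Basis \<Longrightarrow> norm (f' x b) \<le> B"
  shows "norm (f x - f y) \<le> (real DIM('a) * B) * norm (x - y)"
proof (rule differentiable_bound[of UNIV f f'])
  show "(f has_derivative f' x) (at x within UNIV)" for x using der by simp
  show "onorm (f' x) \<le> real DIM('a) * B" for x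
  proof (rule onorm_le)
    fix v
    have lin: "linear (f' x)" using der has_derivative_linear by blast
    have "norm (f' x v) = norm (\<Sum>b\<in>Basis. (v \<bullet> b) *\<^sub>R f' x b)"
      by (subst euclidean_representation[of v, symmetric])
        (simp add: linear_sum[OF lin] linear_cmul[OF lin] del: euclidean_representation)
    also have "\<dots> \<le> (\<Sum>b\<in>(Basis::'a set). norm v * B)"
      using bd by (intro sum_norm_le) (auto intro!: mult_mono simp: Basis_le_norm)
    finally show "norm (f' x v) \<le> real DIM('a) * B * norm v" by (simp add: algebra_simps)
  qed
qed auto

lemma smooth_map_has_derivative:
  "smooth_map f \<Longrightarrow> (f has_derivative frechet_derivative f (at x)) (at x)"
  unfolding smooth_map_def frechet_derivative_works[symmetric]
  using iter_deriv.simps(1)[of f] lists.Nil by metis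

lemma smooth_map_continuous_on: "smooth_map f \<Longrightarrow> continuous_on S f"
  by (auto intro!: continuous_at_imp_continuous_on intro: has_derivative_continuous smooth_map_has_derivative)

lemma smooth_map_partial_continuous_on:
  assumes "smooth_map f" "b \<in> Basis"
  shows "continuous_on S (\<lambda>x. frechet_derivative f (at x) b)"
proof -
  have "[b] \<in> lists Basis" using assms(2) by simp
  then have "iter_deriv [b] f differentiable (at x)" for x
    using assms(1) unfolding smooth_map_def by blast
  then show ?thesis
    by (auto intro!: continuous_at_imp_continuous_on differentiable_imp_continuous_within)
qed

lemma Diff_on_fixes: "f \<in> Diff_on K \<Longrightarrow> x \<notin> K \<Longrightarrow> f x = x"
  unfolding Diff_on_def diffeo_support_def using closure_subset[of "{x. f x \<noteq> x}"] by auto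

lemma Diff_on_lipschitz:
  fixes f :: "'a::euclidean_space \<Rightarrow> 'a"
  assumes f: "f \<in> Diff_on K" and K: "compact K"
  shows "\<exists>L>0. \<forall>x y. norm (f x - f y) \<le> L * norm (x - y)"
proof -
  have sm: "smooth_map f" using f by (simp add: Diff_on_def diffeo_def)
  let ?f' = "\<lambda>x. frechet_derivative f (at x)"
  have "\<exists>B. \<forall>x\<in>K. norm (?f' x b) \<le> B" if "b \<in> Basis" for b
    using compact_imp_bounded[OF compact_continuous_image[OF smooth_map_partial_continuous_on[OF sm that] K]]
    unfolding bounded_iff by auto
  then obtain B where B: "\<And>b x. b \<in> Basis \<Longrightarrow> x \<in> K \<Longrightarrow> norm (?f' x b) \<le> B b"
    by metis
  \<comment> \<open>The summand 1 covers points outside \<open>K\<close>, where the map is locally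
    the identity and its partial derivatives are the basis vectors.\<close>
  define B' where "B' = 1 + (\<Sum>b\<in>Basis. \<bar>B b\<bar>)"
  have "norm (?f' x b) \<le> B'" if b: "b \<in> Basis" for x b
  proof (cases "x \<in> K")
    case True
    have "B b \<le> \<bar>B b\<bar>" by simp
    also have "\<dots> \<le> (\<Sum>b\<in>Basis. \<bar>B b\<bar>)" using b by (intro member_le_sum) auto
    finally show ?thesis using B[OF b True] by (simp add: B'_def)
  next
    case False
    have "((\<lambda>x. x) has_derivative (\<lambda>x. x)) (at x)" by simp
    then have "(f has_derivative (\<lambda>x. x)) (at x)"
      by (rule has_derivative_transform_within_open[of _ _ _ _ "- K"])
        (use False K Diff_on_fixes[OF f] in \<open>auto intro: compact_imp_closed\<close>)
    then have "?f' x = (\<lambda>x. x)" by (metis frechet_derivative_at)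
    moreover have "0 \<le> (\<Sum>b\<in>Basis. \<bar>B b\<bar>)" by (intro sum_nonneg) auto
    ultimately show ?thesis using b by (simp add: B'_def)
  qed
  then have "\<forall>x y. norm (f x - f y) \<le> (real DIM('a) * B') * norm (x - y)"
    using lipschitz_of_partials[OF smooth_map_has_derivative[OF sm]] by blast
  moreover have "B' > 0" unfolding B'_def by (smt (verit) sum_nonneg)
  then have "real DIM('a) * B' > 0" by simp
  ultimately show ?thesis by blast
qed

lemma Diff_on_inv:
  assumes "f \<in> Diff_on K"
  shows "inv f \<in> Diff_on K"
proof -
  have b: "bij f" using assms by (simp add: Diff_on_def diffeo_def)
  have "inv f x = x \<longleftrightarrow> f x = x" for x
    using bij_inv_eq_iff[OF b, of x x] by auto
  then have "{x. inv f x \<noteq> x} = {x. f x \<noteq> x}" by simp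
  then show ?thesis
    using assms by (auto simp: Diff_on_def diffeo_def diffeo_support_def bij_imp_bij_inv inv_inv_eq)
qed

text \<open>Here \<open>k\<close> is the inverse of \<open>h\<close>, and
  \<open>f = (id + D) \<circ> h\<close> with \<open>D = (f - h) \<circ> k\<close>. Its Lipschitz
  constant \<open>\<eta> * L\<close> is at most 1/2, as the isotopy argument requires.\<close>

lemma approximable_perturbation:
  fixes f h k :: "'a::euclidean_space \<Rightarrow> 'a"
  assumes h: "approximable h" "continuous_on UNIV h" and k: "\<And>x. h (k x) = x" "\<And>x. k (h x) = x"
    and E: "\<And>x y. norm ((f x - h x) - (f y - h y)) \<le> \<eta> * norm (x - y)"
    and bd: "\<And>x. norm (f x - h x) \<le> M"
    and L: "\<And>x y. norm (k x - k y) \<le> L * norm (x - y)" and \<eta>: "\<eta> \<ge> 0" "\<eta> * L \<le> 1/2"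
  shows "approximable f"
proof -
  define D where "D x = f (k x) - h (k x)" for x
  have D: "norm (D x - D y) \<le> norm (x - y) / 2" for x y
  proof -
    have "norm (D x - D y) \<le> \<eta> * norm (k x - k y)" unfolding D_def by (rule E)
    also have "\<dots> \<le> \<eta> * (L * norm (x - y))" using L \<eta> by (intro mult_left_mono) auto
    also have "\<dots> \<le> 1/2 * norm (x - y)" using mult_right_mono[OF \<eta>(2) norm_ge_zero] by (simp only: mult.assoc)
    finally show ?thesis by simp
  qed
  have "norm (D x) \<le> M" for x unfolding D_def by (rule bd)
  then have "approximable (\<lambda>x. x + D x)" by (rule approximable_id_plus[OF D])
  moreover have "continuous_on UNIV (\<lambda>x. x + D x)"
  proof -
    have "continuous_on UNIV D"
      using D unfolding continuous_on_iff dist_norm by (smt (verit) norm_ge_zero field_sum_of_halves)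
    then show ?thesis by (intro continuous_intros)
  qed
  ultimately have "approximable ((\<lambda>x. x + D x) \<circ> h)"
    using approximable_comp[OF h] by blast
  moreover have "(\<lambda>x. x + D x) \<circ> h = f" by (auto simp: D_def k)
  ultimately show ?thesis by simp
qed

text \<open>One implication makes the set of approximable maps open, the other makes its complement
  open. For the latter \<open>f\<close> and \<open>h\<close> exchange roles, so the inverse of every
  nearby \<open>f\<close> needs a common Lipschitz bound.\<close>

lemma approximable_near_iff:
  fixes h :: "'a::euclidean_space \<Rightarrow> 'a"
  assumes h: "h \<in> Diff_on K" and K: "compact K"
  shows "\<exists>\<epsilon>>0. \<forall>f\<in>Cr_ball K 1 \<epsilon> h. approximable f \<longleftrightarrow> approximable h"
proof -
  obtain L where L: "L > 0" "\<And>x y. norm (inv h x - inv h y) \<le> L * norm (x - y)"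
    using Diff_on_lipschitz[OF Diff_on_inv[OF h] K] by blast
  \<comment> \<open>Chosen so that \<open>\<eta> * L = 1/4\<close>. This leaves room for the larger
    constant of \<open>inv f\<close>, since 4/3 of it is still below 1/2.\<close>
  define \<epsilon> where "\<epsilon> = 1 / (4 * L * DIM('a))"
  define \<eta> where "\<eta> = DIM('a) * \<epsilon>"
  have \<epsilon>: "\<epsilon> > 0" using L by (simp add: \<epsilon>_def)
  have \<eta>: "\<eta> \<ge> 0" "\<eta> * L = 1/4" using L by (simp_all add: \<epsilon>_def \<eta>_def)
  have smh: "smooth_map h" and bh: "bij h" using h by (simp_all add: Diff_on_def diffeo_def)
  have "approximable f \<longleftrightarrow> approximable h" if fb: "f \<in> Cr_ball K 1 \<epsilon> h" for f
  proof -
    have f: "f \<in> Diff_on K" using fb by (simp add: Cr_ball_def)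
    then have smf: "smooth_map f" and bf: "bij f" by (simp_all add: Diff_on_def diffeo_def)
    have "norm (frechet_derivative f (at x) b - frechet_derivative h (at x) b) \<le> \<epsilon>" if "b \<in> Basis" for x b
    proof -
      have "[b] \<in> lists Basis" "length [b] \<le> 1" using that by auto
      then have "norm (iter_deriv [b] f x - iter_deriv [b] h x) < \<epsilon>"
        using fb unfolding Cr_ball_def by blast
      then show ?thesis by simp
    qed
    then have E: "norm ((f x - h x) - (f y - h y)) \<le> \<eta> * norm (x - y)" for x y
      unfolding \<eta>_def
      by (rule lipschitz_of_partials[OF has_derivative_diff[OF smooth_map_has_derivative[OF smf] smooth_map_has_derivative[OF smh]]])
    have "continuous_on K (\<lambda>x. f x - h x)"
      by (intro continuous_on_diff smooth_map_continuous_on smf smh)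
    then have "compact ((\<lambda>x. f x - h x) ` K)"
      using K by (rule compact_continuous_image)
    then have "\<exists>M>0. \<forall>z\<in>(\<lambda>x. f x - h x) ` K. norm z \<le> M"
      by (intro bounded_pos[THEN iffD1] compact_imp_bounded)
    then obtain M where "M > 0" "\<forall>z\<in>(\<lambda>x. f x - h x) ` K. norm z \<le> M"
      by (elim exE conjE) (rule that)
    then have M: "M > 0" "\<And>x. x \<in> K \<Longrightarrow> norm (f x - h x) \<le> M" by auto
    have bd: "norm (f x - h x) \<le> M" for x
      using M Diff_on_fixes[OF f] Diff_on_fixes[OF h] by (cases "x \<in> K") auto
    have inv: "h (inv h x) = x" "inv h (h x) = x" "f (inv f x) = x" "inv f (f x) = x" for x
      using bh bf by (simp_all add: bij_is_surj bij_is_inj surj_f_inv_f)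
    \<comment> \<open>Absorbing \<open>\<eta> * L = 1/4\<close> of the left-hand side leaves the
      factor \<open>1 / (1 - 1/4) = 4/3\<close>.\<close>
    have Lf: "norm (inv f x - inv f y) \<le> (4/3 * L) * norm (x - y)" for x y
    proof -
      define a b where "a = inv f x" and "b = inv f y"
      have ab: "f a = x" "f b = y" by (auto simp: a_def b_def inv)
      have "norm (a - b) \<le> L * norm (h a - h b)" using L(2)[of "h a" "h b"] by (simp add: inv)
      also have "norm (h a - h b) \<le> norm (x - y) + \<eta> * norm (a - b)"
        using norm_triangle_ineq4[of "f a - f b" "(f a - h a) - (f b - h b)"] E[of a b] ab by simp
      finally have "norm (a - b) \<le> L * norm (x - y) + (\<eta> * L) * norm (a - b)"
        using L(1) by (simp add: mult_left_mono algebra_simps)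
      then show ?thesis by (simp add: a_def[symmetric] b_def[symmetric] \<eta>)
    qed
    show ?thesis
    proof
      assume "approximable h"
      then show "approximable f"
        by (rule approximable_perturbation[OF _ smooth_map_continuous_on[OF smh] inv(1,2) E bd L(2) \<eta>(1)])
          (simp add: \<eta>)
    next
      assume "approximable f"
      then show "approximable h"
      proof (rule approximable_perturbation[OF _ smooth_map_continuous_on[OF smf] inv(3,4) _ _ Lf \<eta>(1)])
        show "norm ((h x - f x) - (h y - f y)) \<le> \<eta> * norm (x - y)" for x y
        proof -
          have "(h x - f x) - (h y - f y) = - ((f x - h x) - (f y - h y))" by simp
          then show ?thesis using E[of x y] by (metis norm_minus_cancel)
        qed
        show "norm (h x - f x) \<le> M" for x using bd[of x] by (simp add: norm_minus_commute)
        show "\<eta> * (4/3 * L) \<le> 1/2" using \<eta>(2) by (simp add: algebra_simps)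
      qed
    qed
  qed
  then have "\<forall>f\<in>Cr_ball K 1 \<epsilon> h. approximable f \<longleftrightarrow> approximable h" by (rule ballI)
  with \<epsilon> show ?thesis by (intro exI[of _ \<epsilon>] conjI)
qed

text \<open>The direct limit topology tests openness on each \<open>Diff_on K\<close> separately, so
  \<open>r\<close> and \<open>\<epsilon>\<close> may depend on \<open>K\<close>.\<close>

lemma openin_Diffc_locally_constant:
  fixes P :: "('a::euclidean_space \<Rightarrow> 'a) \<Rightarrow> bool"
  assumes "\<And>K h. compact K \<Longrightarrow> h \<in> Diff_on K \<Longrightarrow> \<exists>r. \<exists>\<epsilon>>0. \<forall>f\<in>Cr_ball K r \<epsilon> h. P f \<longleftrightarrow> P h"
  shows "openin Diffc_topology {f \<in> Diffc. P f}"
  unfolding openin_Diffc_topology openin_Diff_on_topology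
proof (intro conjI allI impI ballI)
  fix K :: "'a set" and h assume K: "compact K" and h: "h \<in> {f \<in> Diffc. P f} \<inter> Diff_on K"
  then obtain r \<epsilon> where "\<epsilon> > 0" "\<forall>f\<in>Cr_ball K r \<epsilon> h. P f \<longleftrightarrow> P h"
    using assms by blast
  moreover have "Cr_ball K r \<epsilon> h \<subseteq> Diff_on K" by (auto simp: Cr_ball_def)
  ultimately show "\<exists>r. \<exists>\<epsilon>>0. Cr_ball K r \<epsilon> h \<subseteq> {f \<in> Diffc. P f} \<inter> Diff_on K"
    using Diff_on_subset_Diffc[OF K] h by blast
qed auto

lemma Diffc0_approximable:
  fixes Q :: "'a::euclidean_space \<Rightarrow> 'a"
  assumes "Q \<in> Diffc0"
  shows "approximable Q"
proof -
  let ?H = "{f :: 'a \<Rightarrow> 'a. f \<in> Diffc \<and> approximable f}"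
  have near: "\<exists>r. \<exists>\<epsilon>>0. \<forall>f\<in>Cr_ball K r \<epsilon> h. approximable f \<longleftrightarrow> approximable h"
    if "compact K" "h \<in> Diff_on K" for K and h :: "'a \<Rightarrow> 'a"
    using approximable_near_iff[OF that(2,1)] by (rule exI)
  have near': "\<exists>r. \<exists>\<epsilon>>0. \<forall>f\<in>Cr_ball K r \<epsilon> h. \<not> approximable f \<longleftrightarrow> \<not> approximable h"
    if "compact K" "h \<in> Diff_on K" for K and h :: "'a \<Rightarrow> 'a"
    using near[OF that] by (simp only: simp_thms)
  have o: "openin Diffc_topology ?H"
    using near by (rule openin_Diffc_locally_constant)
  have o': "openin Diffc_topology {f :: 'a \<Rightarrow> 'a. f \<in> Diffc \<and> \<not> approximable f}"
    using near' by (rule openin_Diffc_locally_constant)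
  have "Diffc - ?H = {f. f \<in> Diffc \<and> \<not> approximable f}" by blast
  with o' have c: "closedin Diffc_topology ?H" by (auto simp: closedin_def)
  have "(id :: 'a \<Rightarrow> 'a) \<in> Diffc"
    using id_in_Diffc0 connected_component_of_subset_topspace[of Diffc_topology "id :: 'a \<Rightarrow> 'a"]
    unfolding Diffc0_def by auto
  then have "id \<in> ?H"
    using approximable_id by blast
  moreover have "connectedin Diffc_topology (Diffc0 :: ('a \<Rightarrow> 'a) set)"
    unfolding Diffc0_def by (rule connectedin_connected_component_of)
  ultimately have "Diffc0 \<subseteq> ?H"
    using connectedin_clopen_cases[OF _ c o] id_in_Diffc0 unfolding disjnt_iff by blast
  then show ?thesis using assms by blast
qed

lemma flow_approximable_Diffc0:
  assumes "Q \<in> Diffc0" "compact K" "\<epsilon> > 0" "T > 0"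
  shows "flow_approximable T K \<epsilon> Q"
proof -
  \<comment> \<open>Half of \<open>\<epsilon>\<close>, since pointwise strict bounds give only a
    non-strict bound on the supremum.\<close>
  obtain f where f: "reachable f" "\<And>x. x \<in> K \<Longrightarrow> norm (Q x - f x) < \<epsilon> / 2"
    using Diffc0_approximable[OF assms(1)] assms(2) half_gt_zero[OF assms(3)]
    unfolding approximable_def by meson
  obtain u v P where P: "is_control T u v" "is_flow T u v P" "P T = f"
    using reachableD[OF f(1) assms(4)] by blast
  have "(SUP x\<in>K. ereal (norm (Q x - P T x))) \<le> ereal (\<epsilon> / 2)"
    using f(2) P(3) by (intro SUP_least) (auto intro: less_imp_le)
  also have "\<dots> < ereal \<epsilon>" using assms(3) by simp
  finally show ?thesis using P unfolding flow_approximable_def by blast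
qed

section \<open>Exact steering of finite ensembles\<close>

text \<open>
  A list entry \<open>(c, k, a)\<close> stands for a step along the Gaussian centred at \<open>c\<close> with control
  \<open>a *\<^sub>R w k\<close>, where the displacements \<open>w k\<close> are the unknowns to be solved for.
\<close>

definition psteps :: "('a::euclidean_space \<times> 'i \<times> real) list \<Rightarrow> ('i \<Rightarrow> 'a) \<Rightarrow> 'a \<Rightarrow> 'a" where
  "psteps st w = gsteps (map (\<lambda>(c, k, a). (c, a *\<^sub>R w k)) st)"

text \<open>The linearization of \<open>psteps st\<close> in the displacements, at zero
  displacements and at the point \<open>x\<close>.\<close>

definition plin :: "('a::euclidean_space \<times> 'i \<times> real) list \<Rightarrow> ('i \<Rightarrow> 'a) \<Rightarrow> 'a \<Rightarrow> 'a" where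
  "plin st w x = (\<Sum>(c, k, a)\<leftarrow>st. (a * gauss (x - c)) *\<^sub>R w k)"

lemma psteps_zero: "psteps st (\<lambda>k. 0) x = x"
  unfolding psteps_def by (induction st arbitrary: x) auto

text \<open>Strict differentiability at \<open>p\<close> and zero displacements survives
  composition. The number \<open>D\<close> plays the part of the sup norm of \<open>w - w'\<close>
  over an arbitrary index type.\<close>

lemma psteps_strict_diff:
  fixes p :: "'a::euclidean_space"
  assumes "\<eta> > 0"
  shows "\<exists>\<delta>>0. \<forall>w w' x x' D. (\<forall>k. norm (w k) \<le> \<delta>) \<longrightarrow> (\<forall>k. norm (w' k) \<le> \<delta>) \<longrightarrow>
    (\<forall>k. norm (w k - w' k) \<le> D) \<longrightarrow> norm (x - p) \<le> \<delta> \<longrightarrow> norm (x' - p) \<le> \<delta> \<longrightarrow>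
    norm (psteps st w x - psteps st w' x' - (x - x') - plin st (\<lambda>k. w k - w' k) p)
      \<le> \<eta> * (norm (x - x') + D)"
  using assms
proof (induction st arbitrary: \<eta>)
  case Nil
  have "0 \<le> \<eta> * (norm (x - x') + D)" if "\<forall>k. norm (w k - w' k) \<le> D"
    for w w' :: "'b \<Rightarrow> 'a" and x x' :: 'a and D
    using that Nil by (meson add_nonneg_nonneg less_imp_le mult_nonneg_nonneg norm_ge_zero order_trans)
  then show ?case by (intro exI[of _ 1]) (auto simp: psteps_def plin_def)
next
  case (Cons s st)
  obtain c k a where s: "s = (c, k, a)" by (cases s)
  define A where "A = \<bar>a\<bar>"
  define B where "B = (1 + A) * A + 2 * A + 2 * A * A"
  have A: "A \<ge> 0" by (simp add: A_def)
  then have B: "B \<ge> 0" by (simp add: B_def)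
  \<comment> \<open>After the first step the data have grown at most by the factor
    \<open>3 + A\<close>; the remaining steps then use half of \<open>\<eta>\<close>, and the first
    step the other half.\<close>
  define \<eta>' where "\<eta>' = \<eta> / (2 * (3 + A))"
  have \<eta>': "\<eta>' > 0" using Cons.prems A by (simp add: \<eta>'_def)
  from Cons.IH[OF this] obtain \<delta>' where \<delta>': "\<delta>' > 0" and IH:
    "\<And>w w' x x' D. (\<And>k. norm (w k) \<le> \<delta>') \<Longrightarrow> (\<And>k. norm (w' k) \<le> \<delta>') \<Longrightarrow>
    (\<And>k. norm (w k - w' k) \<le> D) \<Longrightarrow> norm (x - p) \<le> \<delta>' \<Longrightarrow> norm (x' - p) \<le> \<delta>' \<Longrightarrow>
    norm (psteps st w x - psteps st w' x' - (x - x') - plin st (\<lambda>k. w k - w' k) p)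
      \<le> \<eta>' * (norm (x - x') + D)" by blast
  \<comment> \<open>In order: intermediate points stay within \<open>\<delta>'\<close> of
    \<open>p\<close>; the first remainder costs at most half of \<open>\<eta>\<close>; controls stay
    below 1/2 for \<open>gstep_strict_diff\<close>; the remainder is at most
    \<open>X\<close>.\<close>
  define \<delta> where "\<delta> = Min {\<delta>' / (1 + A), \<eta> / (2 * (B + 1)), 1 / (2 * (1 + A)), 1 / (B + 1)}"
  have \<delta>: "\<delta> > 0" using \<delta>' Cons.prems A B by (simp add: \<delta>_def add_nonneg_pos)
  have "\<delta> \<le> \<delta>' / (1 + A)" "\<delta> \<le> \<eta> / (2 * (B + 1))" "\<delta> \<le> 1 / (2 * (1 + A))" "\<delta> \<le> 1 / (B + 1)"
    by (simp_all add: \<delta>_def)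
  then have "\<delta> * (1 + A) \<le> \<delta>'" "\<delta> * (2 * (B + 1)) \<le> \<eta>" "\<delta> * (2 * (1 + A)) \<le> 1" "\<delta> * (B + 1) \<le> 1"
    using A B by (simp_all add: pos_le_divide_eq add_nonneg_pos)
  then have small: "(1 + A) * \<delta> \<le> \<delta>'" "\<delta> * B \<le> \<eta> / 2" "A * \<delta> \<le> 1/2" "\<delta> * B \<le> 1"
    using \<delta> by (simp_all add: algebra_simps)
  have "0 \<le> A * \<delta>" using A \<delta> by simp
  then have \<delta>le: "\<delta> \<le> \<delta>'" using small(1) by (simp add: algebra_simps)
  have "norm (psteps (s # st) w x - psteps (s # st) w' x' - (x - x') - plin (s # st) (\<lambda>k. w k - w' k) p)
      \<le> \<eta> * (norm (x - x') + D)"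
    if w: "\<And>k. norm (w k) \<le> \<delta>" "\<And>k. norm (w' k) \<le> \<delta>" and D: "\<And>k. norm (w k - w' k) \<le> D"
      and x: "norm (x - p) \<le> \<delta>" "norm (x' - p) \<le> \<delta>" for w w' :: "'b \<Rightarrow> 'a" and x x' D
  proof -
    define z z' where "z = gstep c (a *\<^sub>R w k) x" and "z' = gstep c (a *\<^sub>R w' k) x'"
    define X where "X = norm (x - x') + D"
    have D0: "D \<ge> 0" using D norm_ge_zero order_trans by blast
    have aw: "norm (a *\<^sub>R w k) \<le> A * \<delta>" "norm (a *\<^sub>R w' k) \<le> A * \<delta>"
      using w A by (simp_all add: A_def mult_left_mono)
    have aD: "norm (a *\<^sub>R w k - a *\<^sub>R w' k) \<le> A * D"
      using D[of k] by (simp add: A_def mult_left_mono flip: scaleR_diff_right)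
    define R where "R = z - z' - (x - x') - (a * gauss (p - c)) *\<^sub>R (w k - w' k)"
    have "R = z - z' - (x - x') - gauss (p - c) *\<^sub>R (a *\<^sub>R w k - a *\<^sub>R w' k)"
      by (simp add: R_def algebra_simps)
    then have "norm R \<le> (norm (x - p) + norm (a *\<^sub>R w k)) * norm (a *\<^sub>R w k - a *\<^sub>R w' k)
        + 2 * (norm (x - x') + norm (a *\<^sub>R w k - a *\<^sub>R w' k)) * norm (a *\<^sub>R w' k)"
      unfolding z_def z'_def using gstep_strict_diff aw(2) small(3) order_trans by metis
    also have "\<dots> \<le> (\<delta> + A * \<delta>) * (A * D) + 2 * (norm (x - x') + A * D) * (A * \<delta>)"
      using x aw aD A \<delta> D0 by (intro add_mono mult_mono mult_left_mono) auto
    also have "\<dots> \<le> \<delta> * B * X"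
    proof -
      have "\<delta> * B * X - ((\<delta> + A * \<delta>) * (A * D) + 2 * (norm (x - x') + A * D) * (A * \<delta>))
        = \<delta> * (((1 + A) * A + 2 * A * A) * norm (x - x') + 2 * A * D)"
        by (simp add: B_def X_def algebra_simps)
      also have "\<dots> \<ge> 0" using A \<delta> D0 by simp
      finally show ?thesis by simp
    qed
    finally have R: "norm R \<le> \<delta> * B * X" .
    have X0: "X \<ge> 0" using D0 by (simp add: X_def)
    have "norm (z - z') \<le> (2 + A) * X"
    proof -
      have eq: "z - z' = R + (x - x') + (a * gauss (p - c)) *\<^sub>R (w k - w' k)" by (simp add: R_def)
      have "norm (z - z') \<le> norm R + norm (x - x') + norm ((a * gauss (p - c)) *\<^sub>R (w k - w' k))"
        unfolding eq using norm_triangle_ineq[of "R + (x - x')" "(a * gauss (p - c)) *\<^sub>R (w k - w' k)"]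
          norm_triangle_ineq[of R "x - x'"] by linarith
      also have "norm ((a * gauss (p - c)) *\<^sub>R (w k - w' k)) \<le> (A * 1) * D"
        unfolding A_def norm_scaleR abs_mult using D[of k] gauss_le_1[of "p - c"]
        by (intro mult_mono) auto
      also have "norm R \<le> 1 * X" using R mult_right_mono[OF small(4) X0] by linarith
      also have "1 * X + norm (x - x') + A * 1 * D \<le> (2 + A) * X"
        using A D0 by (simp add: X_def algebra_simps)
      finally show ?thesis by simp
    qed
    moreover have "D \<le> X" by (simp add: X_def)
    ultimately have zz: "norm (z - z') + D \<le> (3 + A) * X"
      by (simp add: algebra_simps)
    have zp: "norm (z - p) \<le> \<delta>'" "norm (z' - p) \<le> \<delta>'"
    proof -
      have "norm (gstep c (a *\<^sub>R v k) y - p) \<le> \<delta>'" if "norm (a *\<^sub>R v k) \<le> A * \<delta>" "norm (y - p) \<le> \<delta>" for v y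
        using norm_triangle_ineq[of "gstep c (a *\<^sub>R v k) y - y" "y - p"] norm_gstep_diff_le[of c "a *\<^sub>R v k" y]
          that small(1) by (simp add: algebra_simps)
      then show "norm (z - p) \<le> \<delta>'" "norm (z' - p) \<le> \<delta>'" using aw x by (auto simp: z_def z'_def)
    qed
    define S where "S = psteps st w z - psteps st w' z' - (z - z') - plin st (\<lambda>k. w k - w' k) p"
    have "norm S \<le> \<eta>' * (norm (z - z') + D)"
      unfolding S_def using w D zp \<delta>le by (intro IH) (auto intro: order_trans)
    also have "\<dots> \<le> \<eta>' * ((3 + A) * X)" using zz \<eta>' by (intro mult_left_mono) auto
    also have "\<dots> = \<eta> / 2 * X" using A by (simp add: \<eta>'_def field_simps)
    finally have S: "norm S \<le> \<eta> / 2 * X" .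
    have R': "norm R \<le> \<eta> / 2 * X" using R mult_right_mono[OF small(2) X0] by linarith
    have "psteps (s # st) w x - psteps (s # st) w' x' - (x - x') - plin (s # st) (\<lambda>k. w k - w' k) p = R + S"
      by (simp add: R_def S_def z_def z'_def s psteps_def plin_def)
    then show ?thesis using norm_triangle_ineq[of R S] R' S by (simp add: X_def)
  qed
  then show ?case using \<delta> by (intro exI[of _ \<delta>]) blast
qed

text \<open>Picard iteration from 0 in the sup norm, with uniform bounds over the indices. The orbit
  stays in the ball: half of \<open>\<delta>\<close> comes from \<open>T0\<close>, half from
  contraction.\<close>

lemma contraction_fixpoint:
  fixes T :: "('i \<Rightarrow> 'a::banach) \<Rightarrow> 'i \<Rightarrow> 'a"
  assumes T0: "\<And>k. norm (T (\<lambda>k. 0) k) \<le> \<delta> / 2"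
    and lip: "\<And>w w' D k. (\<And>k. norm (w k) \<le> \<delta>) \<Longrightarrow> (\<And>k. norm (w' k) \<le> \<delta>) \<Longrightarrow>
      (\<And>k. norm (w k - w' k) \<le> D) \<Longrightarrow> norm (T w k - T w' k) \<le> D / 2"
  shows "\<exists>w. (\<forall>k. norm (w k) \<le> \<delta>) \<and> T w = w"
proof -
  define w where "w n = (T ^^ n) (\<lambda>k. 0)" for n
  have wS: "w (Suc n) = T (w n)" for n by (simp add: w_def)
  have \<delta>: "\<delta> \<ge> 0" using T0[of undefined] norm_ge_zero[of "T (\<lambda>k. 0) undefined"] by linarith
  have bound: "norm (w n k) \<le> \<delta>" for n k
  proof (induction n arbitrary: k)
    case 0
    show ?case using \<delta> by (simp add: w_def)
  next
    case (Suc n)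
    have "norm (T (w n) k - T (\<lambda>k. 0) k) \<le> \<delta> / 2"
      by (rule lip) (use Suc \<delta> in auto)
    then show ?case
      using T0[of k] norm_triangle_ineq[of "T (w n) k - T (\<lambda>k. 0) k" "T (\<lambda>k. 0) k"] by (simp add: wS)
  qed
  have tail: "norm (w (m + n) k - w n k) \<le> \<delta> * (1/2) ^ n" for m n k
  proof (induction n arbitrary: k)
    case 0
    show ?case using bound[of m k] by (simp add: w_def)
  next
    case (Suc n)
    have "norm (T (w (m + n)) k - T (w n) k) \<le> \<delta> * (1/2) ^ n / 2"
      by (rule lip) (use Suc bound in auto)
    then show ?case by (simp add: wS)
  qed
  have lim0: "(\<lambda>n. \<delta> * (1/2) ^ n) \<longlonglongrightarrow> 0"
    by (intro tendsto_mult_right_zero LIMSEQ_realpow_zero) auto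
  have "Cauchy (\<lambda>n. w n k)" for k
  proof (rule metric_CauchyI)
    fix e :: real assume "e > 0"
    then obtain N where N: "\<delta> * (1/2) ^ N < e / 2"
      using order_tendstoD(2)[OF lim0, of "e / 2"] by (auto simp: eventually_sequentially)
    have "dist (w m k) (w N k) < e / 2" if "m \<ge> N" for m
      using tail[of "m - N" N k] that N by (simp add: dist_norm)
    then show "\<exists>M. \<forall>m\<ge>M. \<forall>n\<ge>M. dist (w m k) (w n k) < e"
      by (meson dist_triangle_half_l)
  qed
  then have "\<forall>k. \<exists>l. (\<lambda>n. w n k) \<longlonglongrightarrow> l"
    using Cauchy_convergent convergent_def by blast
  then obtain W where W: "\<And>k. (\<lambda>n. w n k) \<longlonglongrightarrow> W k" by metis
  \<comment> \<open>Letting \<open>m\<close> tend to infinity in \<open>tail\<close> gives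
    convergence uniform in \<open>k\<close>, the form that \<open>lip\<close> accepts.\<close>
  have Wtail: "norm (W k - w n k) \<le> \<delta> * (1/2) ^ n" for k n
  proof (rule tendsto_upperbound)
    show "(\<lambda>m. norm (w (m + n) k - w n k)) \<longlonglongrightarrow> norm (W k - w n k)"
      by (intro tendsto_intros LIMSEQ_ignore_initial_segment W)
  qed (use tail in auto)
  have Wb: "norm (W k) \<le> \<delta>" for k using Wtail[of k 0] by (simp add: w_def)
  have "T W k = W k" for k
  proof (rule LIMSEQ_unique)
    show "(\<lambda>n. w (Suc n) k) \<longlonglongrightarrow> W k" using W by (rule LIMSEQ_Suc)
    have "norm (w (Suc n) k - T W k) \<le> \<delta> * (1/2) ^ n" for n
    proof -
      have "norm (T (w n) k - T W k) \<le> \<delta> * (1/2) ^ n / 2"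
        by (rule lip) (use Wtail Wb bound in \<open>auto simp: norm_minus_commute\<close>)
      also have "\<dots> \<le> \<delta> * (1/2) ^ n" using \<delta> by simp
      finally show ?thesis by (simp add: wS)
    qed
    then have "(\<lambda>n. w (Suc n) k - T W k) \<longlonglongrightarrow> 0"
      by (intro Lim_null_comparison[OF _ lim0]) auto
    then show "(\<lambda>n. w (Suc n) k) \<longlonglongrightarrow> T W k" by (simp add: LIM_zero_iff)
  qed
  then show ?thesis using Wb by (intro exI[of _ W]) auto
qed

section \<open>Steering between ensembles near a given one\<close>

definition steerable :: "'i set \<Rightarrow> ('i \<Rightarrow> 'a::euclidean_space) \<Rightarrow> ('i \<Rightarrow> 'a) \<Rightarrow> bool" where
  "steerable I q r \<longleftrightarrow> (\<exists>f. reachable f \<and> (\<forall>k\<in>I. f (q k) = r k))"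

lemma steerable_trans: "steerable I q r \<Longrightarrow> steerable I r s \<Longrightarrow> steerable I q s"
  unfolding steerable_def using reachable_comp by metis

lemma gauss_interpolation:
  fixes p :: "'i \<Rightarrow> 'a::euclidean_space"
  assumes I: "finite I" "inj_on p I" and e: "e > 0"
  shows "\<exists>st :: ('a \<times> 'i \<times> real) list. \<forall>w D j. j \<in> I \<longrightarrow> (\<forall>k. norm (w k) \<le> D) \<longrightarrow> norm (w j - plin st w (p j)) \<le> e * D"
proof -
  \<comment> \<open>The added 1 keeps \<open>N\<close> positive for empty \<open>I\<close>.\<close>
  define N where "N = real (card I) + 1"
  have N: "N > 0" by (simp add: N_def)
  have "\<exists>l. \<forall>x\<in>p ` I. \<bar>(if x = p k then 1 else 0) - (\<Sum>(c, a)\<leftarrow>l. a * gauss (x - c))\<bar> < e / N" for k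
    using I e N by (intro gauss_sum_dense finite_imp_compact continuous_on_finite) auto
  then obtain l where l: "\<And>k x. x \<in> p ` I \<Longrightarrow>
      \<bar>(if x = p k then 1 else 0) - (\<Sum>(c, a)\<leftarrow>l k. a * gauss (x - c))\<bar> < e / N" by metis
  define G where "G k x = (\<Sum>(c, a)\<leftarrow>l k. a * gauss (x - c))" for k x
  obtain ks where ks: "set ks = I" "distinct ks" using finite_distinct_list[OF I(1)] by blast
  define st where "st = concat (map (\<lambda>k. map (\<lambda>(c, a). (c, k, a)) (l k)) ks)"
  have block: "(\<Sum>(c, k, a)\<leftarrow>map (\<lambda>(c, a). (c, k, a)) m. (a * gauss (x - c)) *\<^sub>R w k)
      = (\<Sum>(c, a)\<leftarrow>m. a * gauss (x - c)) *\<^sub>R w k" for m k and w :: "'i \<Rightarrow> 'a" and x :: 'a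
    by (induction m) (auto simp: algebra_simps)
  have "plin st w x = (\<Sum>k\<leftarrow>ks. G k x *\<^sub>R w k)" for w :: "'i \<Rightarrow> 'a" and x
    unfolding st_def plin_def G_def by (induction ks) (auto simp: block simp del: map_map)
  then have plin: "plin st w x = (\<Sum>k\<in>I. G k x *\<^sub>R w k)" for w :: "'i \<Rightarrow> 'a" and x
    using ks sum_list_distinct_conv_sum_set by metis
  have "norm (w j - plin st w (p j)) \<le> e * D" if j: "j \<in> I" and w: "\<And>k. norm (w k) \<le> D" for w D j
  proof -
    have D: "D \<ge> 0" using w norm_ge_zero order_trans by blast
    have "w j = (\<Sum>k\<in>I. (if p j = p k then 1 else 0) *\<^sub>R w k)"
    proof -
      have "(\<Sum>k\<in>I. (if p j = p k then 1 else 0) *\<^sub>R w k) = (\<Sum>k\<in>I. if k = j then w k else 0)"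
        using I(2) j by (intro sum.cong) (auto dest: inj_onD)
      then show ?thesis using I(1) j by simp
    qed
    then have "w j - plin st w (p j) = (\<Sum>k\<in>I. ((if p j = p k then 1 else 0) - G k (p j)) *\<^sub>R w k)"
      by (simp add: plin scaleR_diff_left sum_subtractf)
    also have "norm \<dots> \<le> (\<Sum>k\<in>I. e / N * D)"
    proof (rule sum_norm_le)
      fix k
      have "\<bar>(if p j = p k then 1 else 0) - G k (p j)\<bar> \<le> e / N"
        using l[of "p j" k] j by (simp add: G_def)
      then show "norm (((if p j = p k then 1 else 0) - G k (p j)) *\<^sub>R w k) \<le> e / N * D"
        unfolding norm_scaleR using w[of k] e N by (intro mult_mono) auto
    qed
    also have "\<dots> = (card I / N) * (e * D)" by simp
    also have "\<dots> \<le> 1 * (e * D)" using D e by (intro mult_right_mono) (auto simp: N_def)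
    finally show ?thesis by simp
  qed
  then show ?thesis by blast
qed

lemma steerable_locally:
  fixes p :: "'i \<Rightarrow> 'a::euclidean_space"
  assumes I: "finite I" "inj_on p I"
  shows "\<exists>\<delta>>0. \<forall>q r. (\<forall>k\<in>I. norm (q k - p k) \<le> \<delta>) \<longrightarrow> (\<forall>k\<in>I. norm (r k - p k) \<le> \<delta>) \<longrightarrow> steerable I q r"
proof -
  obtain st :: "('a \<times> 'i \<times> real) list" where
    st: "\<And>w D j. j \<in> I \<Longrightarrow> (\<And>k. norm (w k) \<le> D) \<Longrightarrow> norm (w j - plin st w (p j)) \<le> 1/4 * D"
    using gauss_interpolation[OF I, of "1/4"] by auto
  define Q where "Q j \<delta> \<longleftrightarrow> (\<forall>w w' x x' D. (\<forall>k. norm (w k) \<le> \<delta>) \<longrightarrow> (\<forall>k. norm (w' k) \<le> \<delta>) \<longrightarrow>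
    (\<forall>k. norm (w k - w' k) \<le> D) \<longrightarrow> norm (x - p j) \<le> \<delta> \<longrightarrow> norm (x' - p j) \<le> \<delta> \<longrightarrow>
    norm (psteps st w x - psteps st w' x' - (x - x') - plin st (\<lambda>k. w k - w' k) (p j))
      \<le> 1/4 * (norm (x - x') + D))" for j \<delta>
  have "\<exists>\<delta>>0. Q j \<delta>" for j
    unfolding Q_def by (rule psteps_strict_diff) simp
  then obtain \<delta> where \<delta>: "\<And>j. \<delta> j > 0" and Q: "\<And>j. Q j (\<delta> j)" by metis
  have sd: "norm (psteps st w x - psteps st w' x' - (x - x') - plin st (\<lambda>k. w k - w' k) (p j))
      \<le> 1/4 * (norm (x - x') + D)"
    if "\<forall>k. norm (w k) \<le> \<delta> j" "\<forall>k. norm (w' k) \<le> \<delta> j" "\<forall>k. norm (w k - w' k) \<le> D"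
      "norm (x - p j) \<le> \<delta> j" "norm (x' - p j) \<le> \<delta> j" for j w w' x x' D
    using Q[of j, unfolded Q_def, rule_format, of w w' D x x'] that by blast
  define d where "d = Min (insert 1 (\<delta> ` I))"
  have d: "d > 0" "\<And>j. j \<in> I \<Longrightarrow> d \<le> \<delta> j" using I(1) \<delta> by (auto simp: d_def)
  have "steerable I q r"
    if q: "\<And>k. k \<in> I \<Longrightarrow> norm (q k - p k) \<le> d / 4" and r: "\<And>k. k \<in> I \<Longrightarrow> norm (r k - p k) \<le> d / 4" for q r
  proof -
    \<comment> \<open>A fixed point satisfies \<open>psteps st w (q j) = r j\<close> on
      \<open>I\<close>. The contraction factor 1/2 is 1/4 from interpolation plus 1/4 from strict
      differentiability; \<open>T\<close> at zero is \<open>r j - q j\<close>, of norm at most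
      \<open>d / 2\<close>.\<close>
    define T where "T w j = (if j \<in> I then w j + r j - psteps st w (q j) else 0)" for w j
    have "\<exists>w. (\<forall>k. norm (w k) \<le> d) \<and> T w = w"
    proof (rule contraction_fixpoint)
      show "norm (T (\<lambda>k. 0) j) \<le> d / 2" for j
        using q[of j] r[of j] d(1) norm_triangle_ineq4[of "r j - p j" "q j - p j"]
        by (auto simp: T_def psteps_zero)
      fix w w' :: "'i \<Rightarrow> 'a" and D j
      assume w: "\<And>k. norm (w k) \<le> d" "\<And>k. norm (w' k) \<le> d" and D: "\<And>k. norm (w k - w' k) \<le> D"
      show "norm (T w j - T w' j) \<le> D / 2"
      proof (cases "j \<in> I")
        case True
        have 1: "norm (w j - w' j - plin st (\<lambda>k. w k - w' k) (p j)) \<le> 1/4 * D"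
          using st[OF True, of "\<lambda>k. w k - w' k" D] D by simp
        have qj: "norm (q j - p j) \<le> \<delta> j" using q[OF True] d(2)[OF True] d(1) by linarith
        have 2: "norm (psteps st w (q j) - psteps st w' (q j) - (q j - q j) - plin st (\<lambda>k. w k - w' k) (p j))
            \<le> 1/4 * (norm (q j - q j) + D)"
          using w D d(2)[OF True] qj by (intro sd) (auto intro: order_trans)
        have eq: "T w j - T w' j = (w j - w' j - plin st (\<lambda>k. w k - w' k) (p j))
          - (psteps st w (q j) - psteps st w' (q j) - (q j - q j) - plin st (\<lambda>k. w k - w' k) (p j))"
          using True by (simp add: T_def algebra_simps)
        have "norm (T w j - T w' j) \<le> 1/4 * D + 1/4 * (norm (q j - q j) + D)"
          unfolding eq by (intro norm_triangle_le_diff add_mono 1 2)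
        then show ?thesis by simp
      next
        case False
        then show ?thesis using order_trans[OF norm_ge_zero D[of j]] by (simp add: T_def)
      qed
    qed
    then obtain w where w: "T w = w" by blast
    have "psteps st w (q j) = r j" if "j \<in> I" for j
      using fun_cong[OF w, of j] that by (simp add: T_def algebra_simps)
    then show ?thesis unfolding steerable_def psteps_def using reachable_gsteps by blast
  qed
  then show ?thesis using d(1) by (intro exI[of _ "d / 4"]) auto
qed

section \<open>From local to global steering\<close>

lemma steerable_along_connected:
  fixes F :: "'b::metric_space \<Rightarrow> 'i \<Rightarrow> 'a::euclidean_space"
  assumes I: "finite I" and S: "connected S" "a \<in> S" "b \<in> S"
    and cont: "\<And>k. k \<in> I \<Longrightarrow> continuous_on S (\<lambda>x. F x k)"
    and inj: "\<And>x. x \<in> S \<Longrightarrow> inj_on (F x) I"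
  shows "steerable I (F a) (F b)"
\<comment> \<open>Near each \<open>x\<close>, any two ensembles are steerable to each other in both
  orders; connectedness of \<open>S\<close> links \<open>a\<close> to \<open>b\<close> by a chain of
  such pairs.\<close>
proof (rule connected_equivalence_relation_gen[OF S,
      where R = "\<lambda>x y. steerable I (F x) (F y)" and P = "\<lambda>_. True"])
  fix x assume x: "x \<in> S"
  obtain \<delta> where \<delta>: "\<delta> > 0" and st: "\<And>q r. (\<forall>k\<in>I. norm (q k - F x k) \<le> \<delta>) \<Longrightarrow>
      (\<forall>k\<in>I. norm (r k - F x k) \<le> \<delta>) \<Longrightarrow> steerable I q r"
    using steerable_locally[OF I inj[OF x]] by blast
  have "\<forall>\<^sub>F y in at x within S. \<forall>k\<in>I. dist (F y k) (F x k) < \<delta>"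
  proof (intro eventually_ball_finite[OF I] ballI)
    fix k assume "k \<in> I"
    then show "\<forall>\<^sub>F y in at x within S. dist (F y k) (F x k) < \<delta>"
      using cont x \<delta> by (auto simp: continuous_on intro: tendstoD)
  qed
  then obtain d where d: "d > 0" "\<And>y. y \<in> S \<Longrightarrow> y \<noteq> x \<Longrightarrow> dist y x < d \<Longrightarrow> \<forall>k\<in>I. dist (F y k) (F x k) < \<delta>"
    unfolding eventually_at by blast
  have near: "\<forall>k\<in>I. norm (F y k - F x k) \<le> \<delta>" if "y \<in> S \<inter> ball x d" for y
    using d(2)[of y] that \<delta> by (cases "y = x") (auto simp: dist_norm[symmetric] dist_commute less_imp_le)
  show "\<exists>T. openin (top_of_set S) T \<and> x \<in> T \<and> (\<forall>y\<in>T. \<forall>z\<in>T. True \<and> True \<longrightarrow> steerable I (F y) (F z))"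
  proof (intro exI[of _ "S \<inter> ball x d"] conjI ballI impI)
    show "steerable I (F y) (F z)" if "y \<in> S \<inter> ball x d" "z \<in> S \<inter> ball x d" for y z
      using near[OF that(1)] near[OF that(2)] by (rule st)
    show "openin (top_of_set S) (S \<inter> ball x d)" by (intro openin_open_Int open_ball)
    show "x \<in> S \<inter> ball x d" using x d(1) by simp
  qed
next
  show "steerable I (F x) (F z)" if "steerable I (F x) (F y)" "steerable I (F y) (F z)" for x y z
    using that by (rule steerable_trans)
  show "\<exists>z. z \<in> T \<and> True" if "x \<in> T" for T and x :: 'b
    using that by blast
qed simp_all

text \<open>In dimension at least 2 the complement of the other points is connected, so the moving
  point can avoid them.\<close>

lemma steerable_move_one:
  fixes x :: "'i \<Rightarrow> 'a::euclidean_space"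
  assumes "finite I" "inj_on x I" "2 \<le> DIM('a)" "k \<in> I" "y \<notin> x ` (I - {k})"
  shows "steerable I x (x(k := y))"
proof -
  have "steerable I (x(k := x k)) (x(k := y))"
  proof (rule steerable_along_connected[OF assms(1), of "- x ` (I - {k})" "x k" y "\<lambda>z. x(k := z)"])
    show "connected (- x ` (I - {k}))"
      using assms(1,3) by (intro path_connected_imp_connected path_connected_complement_countable)
        (auto intro: countable_finite)
    show "continuous_on (- x ` (I - {k})) (\<lambda>z. (x(k := z)) j)" for j
      by (cases "j = k") auto
    show "inj_on (x(k := z)) I" if "z \<in> - x ` (I - {k})" for z
      using that assms(2) by (auto simp: inj_on_def)
    show "x k \<in> - x ` (I - {k})" using assms(2,4) by (auto simp: inj_on_def)
  qed (use assms in auto)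
  then show ?thesis by simp
qed

text \<open>Points are moved to their targets one at a time. Disjointness keeps every mixed ensemble
  injective and every next target unoccupied.\<close>

lemma steerable_disjoint:
  fixes x y :: "'i \<Rightarrow> 'a::euclidean_space"
  assumes I: "finite I" and d: "2 \<le> DIM('a)" and inj: "inj_on x I" "inj_on y I" and disj: "x ` I \<inter> y ` I = {}"
  shows "steerable I x y"
proof -
  have "steerable I x (\<lambda>k. if k \<in> J then y k else x k)" if "J \<subseteq> I" for J
    using finite_subset[OF that I] that
  proof (induction J)
    case empty
    show ?case using reachable_id by (auto simp: steerable_def)
  next
    case (insert j J)
    let ?z = "\<lambda>k. if k \<in> J then y k else x k"
    have xy: "x a \<noteq> y b" if "a \<in> I" "b \<in> I" for a b
      using disj that by (metis IntI empty_iff imageI)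
    have "inj_on ?z I"
    proof (rule inj_onI)
      fix a b assume "a \<in> I" "b \<in> I" "?z a = ?z b"
      then show "a = b"
        using inj_onD[OF inj(1), of a b] inj_onD[OF inj(2), of a b] xy[of a b] xy[of b a]
        by (auto split: if_splits)
    qed
    moreover have "y j \<notin> ?z ` (I - {j})"
    proof
      assume "y j \<in> ?z ` (I - {j})"
      then obtain a where "a \<in> I" "a \<noteq> j" "y j = ?z a" by blast
      then show False
        using inj_onD[OF inj(2), of a j] xy[of a j] insert.prems by (auto split: if_splits)
    qed
    ultimately have "steerable I ?z (?z(j := y j))"
      using insert.prems by (intro steerable_move_one I d) auto
    moreover have "?z(j := y j) = (\<lambda>k. if k \<in> insert j J then y k else x k)" by auto
    ultimately show ?case using insert steerable_trans by (metis insert_subset)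
  qed
  from this[OF order_refl] show ?thesis by (simp add: steerable_def)
qed

text \<open>Targets may be occupied by other initial points, as for a permutation; a detour through
  an ensemble disjoint from both avoids this.\<close>

lemma steerable_of_dim_ge_2:
  fixes x y :: "'i \<Rightarrow> 'a::euclidean_space"
  assumes I: "finite I" and d: "2 \<le> DIM('a)" and inj: "inj_on x I" "inj_on y I"
  shows "steerable I x y"
proof -
  have "infinite (UNIV :: 'a set)"
    using finite_imp_bounded not_bounded_UNIV by blast
  then have "infinite (- (x ` I \<union> y ` I))"
    using finite_compl[of "x ` I \<union> y ` I"] I by blast
  then obtain B where B: "B \<subseteq> - (x ` I \<union> y ` I)" "finite B" "card B = card I"
    using infinite_arbitrarily_large by metis
  obtain z where "bij_betw z I B" using finite_same_card_bij[OF I B(2)] B(3) by metis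
  then have z: "inj_on z I" "z ` I = B" by (auto simp: bij_betw_def)
  have "steerable I x z" by (rule steerable_disjoint[OF I d inj(1) z(1)]) (use z B in auto)
  moreover have "steerable I z y" by (rule steerable_disjoint[OF I d z(1) inj(2)]) (use z B in auto)
  ultimately show ?thesis by (rule steerable_trans)
qed

lemma steerable_ordered:
  fixes x y :: "'i \<Rightarrow> real"
  assumes I: "finite I" and inj: "inj_on x I" "inj_on y I"
    and ord: "\<And>i j. i \<in> I \<Longrightarrow> j \<in> I \<Longrightarrow> x i < x j \<longleftrightarrow> y i < y j"
  shows "steerable I x y"
proof -
  define F where "F s k = (1 - s) * x k + s * y k" for s :: real and k
  have lt: "F s i < F s j" if "s \<in> {0..1}" "i \<in> I" "j \<in> I" "x i < x j" for s i j
  proof -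
    have y: "y i < y j" using ord that by blast
    show ?thesis
    \<comment> \<open>For \<open>s > 0\<close> strictness comes from the \<open>y\<close> part
      alone, which degenerates at \<open>s = 0\<close>.\<close>
    proof (cases "s = 0")
      case False
      then have "(1 - s) * x i \<le> (1 - s) * x j" "s * y i < s * y j"
        using that y by (auto intro!: mult_left_mono)
      then show ?thesis unfolding F_def by linarith
    qed (use that in \<open>simp add: F_def\<close>)
  qed
  have "steerable I (F 0) (F 1)"
  proof (rule steerable_along_connected[OF I, of "{0..1}"])
    show "inj_on (F s) I" if "s \<in> {0..1}" for s
    proof (rule inj_onI)
      fix i j assume ij: "i \<in> I" "j \<in> I" "F s i = F s j"
      then have "\<not> x i < x j" "\<not> x j < x i" using lt[OF that] by (metis order_less_irrefl)+
      then show "i = j" using ij inj(1) by (auto dest: inj_onD)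
    qed
    show "continuous_on {0..1} (\<lambda>s. F s k)" for k
      unfolding F_def by (intro continuous_intros)
  qed auto
  moreover have "F 0 = x" "F 1 = y" by (auto simp: F_def)
  ultimately show ?thesis by simp
qed

lemma ensemble_steerableI:
  assumes "steerable {1..N} x y" "T > 0"
  shows "ensemble_steerable T N x y"
proof -
  obtain f where f: "reachable f" "\<And>k. k \<in> {1..N} \<Longrightarrow> f (x k) = y k"
    using assms(1) unfolding steerable_def by blast
  obtain u v P where P: "is_control T u v" "is_flow T u v P" "P T = f"
    using reachableD[OF f(1) assms(2)] by blast
  have "\<exists>z. trajectory T u v (x k) z \<and> z T = y k" if "k \<in> {1..N}" for k
    using P f(2)[OF that] by (intro exI[of _ "\<lambda>t. P t (x k)"]) (auto simp: is_flow_def)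
  then show ?thesis using P(1) unfolding ensemble_steerable_def by blast
qed

section \<open>Trajectories on the line do not cross\<close>

text \<open>
  Near a first time \<open>\<tau>\<close> at which two trajectories meet, Gronwall's argument run backwards from
  \<open>\<tau>\<close> forces them to coincide on an interval before \<open>\<tau>\<close>.
\<close>

lemma trajectories_ordered:
  fixes z1 z2 :: "real \<Rightarrow> real"
  assumes ctl: "is_control T u v" and z1: "trajectory T u v x1 z1" and z2: "trajectory T u v x2 z2"
    and T: "T > 0" and less: "x1 < x2"
  shows "z1 T < z2 T"
proof (rule ccontr)
  assume "\<not> z1 T < z2 T"
  define d where "d t = z2 t - z1 t" for t
  have cd: "continuous_on {0..T} d"
    using z1 z2 unfolding d_def trajectory_def by (intro continuous_intros) auto
  have d0: "d 0 > 0" using trajectory_0[OF z1] trajectory_0[OF z2] T less by (simp add: d_def)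
  have dT: "d T \<le> 0" using \<open>\<not> z1 T < z2 T\<close> by (simp add: d_def)
  define Z where "Z = {t \<in> {0..T}. d t = 0}"
  have "compact Z"
  proof -
    have "closed Z" unfolding Z_def using continuous_closed_preimage_constant[OF cd, of 0] by simp
    then have "compact ({0..T} \<inter> Z)" by (intro compact_Int_closed compact_Icc)
    moreover have "{0..T} \<inter> Z = Z" by (auto simp: Z_def)
    ultimately show ?thesis by simp
  qed
  moreover have "Z \<noteq> {}"
    using IVT2'[of d T 0 0] cd d0 dT T unfolding Z_def by fastforce
  ultimately obtain \<tau> where \<tau>: "\<tau> \<in> Z" "\<And>t. t \<in> Z \<Longrightarrow> \<tau> \<le> t"
    using compact_attains_inf[of Z] by blast
  have \<tau>T: "0 < \<tau>" "\<tau> \<le> T" "d \<tau> = 0" using \<tau>(1) d0 by (auto simp: Z_def less_le)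
  \<comment> \<open>The common control \<open>v\<close> cancels in this difference, leaving the
    difference of Gaussians times \<open>u\<close>.\<close>
  define w where "w s = rhs (z2 s) (u s) (v s) - rhs (z1 s) (u s) (v s)" for s
  have w: "(w has_integral (d t - d 0)) {0..t}" if "t \<in> {0..T}" for t
  proof -
    have "(w has_integral ((z2 t - x2) - (z1 t - x1))) {0..t}"
      unfolding w_def using z1 z2 that unfolding trajectory_def by (intro has_integral_diff) auto
    then show ?thesis
      using trajectory_0[OF z1] trajectory_0[OF z2] T by (simp add: d_def algebra_simps)
  qed
  have au: "(\<lambda>s. \<bar>u s\<bar>) integrable_on {0..T}"
    using ctl by (auto simp: is_control_def absolutely_integrable_on_def)
  define U where "U t = integral {0..t} (\<lambda>s. \<bar>u s\<bar>)" for t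
  have "continuous_on {0..T} U" unfolding U_def by (rule indefinite_integral_continuous_1[OF au])
  then obtain \<rho> where \<rho>: "\<rho> > 0" "\<And>t. t \<in> {0..T} \<Longrightarrow> dist t \<tau> < \<rho> \<Longrightarrow> dist (U t) (U \<tau>) < 1/2"
    unfolding continuous_on_iff using \<tau>T
    by (metis atLeastAtMost_iff less_eq_real_def zero_less_divide_1_iff zero_less_numeral)
  \<comment> \<open>On \<open>{\<sigma>..\<tau>}\<close> the integral of
    \<open>\<bar>u s\<bar>\<close> is below 1/2; halving \<open>\<rho>\<close> makes the distance
    strict, and the maximum with 0 stays in the time interval.\<close>
  define \<sigma> where "\<sigma> = max 0 (\<tau> - \<rho> / 2)"
  have \<sigma>: "0 \<le> \<sigma>" "\<sigma> < \<tau>" "\<tau> - \<sigma> < \<rho>" using \<rho>(1) \<tau>T by (auto simp: \<sigma>_def)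
  have "continuous_on {\<sigma>..\<tau>} (\<lambda>t. \<bar>d t\<bar>)"
    using cd \<sigma> \<tau>T by (intro continuous_on_rabs) (auto intro: continuous_on_subset)
  then obtain m where m: "m \<in> {\<sigma>..\<tau>}" "\<And>t. t \<in> {\<sigma>..\<tau>} \<Longrightarrow> \<bar>d t\<bar> \<le> \<bar>d m\<bar>"
    using continuous_attains_sup[of "{\<sigma>..\<tau>}" "\<lambda>t. \<bar>d t\<bar>"] \<sigma> by auto
  have m0T: "0 \<le> m" "m \<le> \<tau>" using m \<sigma> by auto
  \<comment> \<open>As \<open>d \<tau> = 0\<close>, \<open>d m\<close> is minus the integral of
    \<open>w\<close> over \<open>{m..\<tau>}\<close>, and there
    \<open>\<bar>w s\<bar> \<le> \<bar>d m\<bar> * \<bar>u s\<bar>\<close> by maximality of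
    \<open>m\<close>.\<close>
  have "\<bar>d m\<bar> \<le> \<bar>d m\<bar> * (1/2)"
  proof -
    have iw: "w integrable_on {0..\<tau>}" and iu: "(\<lambda>s. \<bar>u s\<bar>) integrable_on {0..\<tau>}"
      using w[of \<tau>] \<tau>T au integrable_on_subinterval[OF au] by (auto simp: integrable_on_def)
    have "integral {0..m} w + integral {m..\<tau>} w = integral {0..\<tau>} w"
      using m0T iw by (rule Henstock_Kurzweil_Integration.integral_combine)
    then have 1: "integral {m..\<tau>} w = - d m"
      using integral_unique[OF w[of m]] integral_unique[OF w[of \<tau>]] m0T \<tau>T by simp
    have "integral {0..m} (\<lambda>s. \<bar>u s\<bar>) + integral {m..\<tau>} (\<lambda>s. \<bar>u s\<bar>) = integral {0..\<tau>} (\<lambda>s. \<bar>u s\<bar>)"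
      using m0T iu by (rule Henstock_Kurzweil_Integration.integral_combine)
    then have "integral {m..\<tau>} (\<lambda>s. \<bar>u s\<bar>) = U \<tau> - U m" by (simp add: U_def)
    also have "\<dots> \<le> dist (U m) (U \<tau>)" by (simp add: dist_real_def)
    also have "\<dots> \<le> 1/2"
      using \<rho>(2)[of m] m \<sigma> \<tau>T by (auto simp: dist_real_def less_imp_le)
    finally have 2: "integral {m..\<tau>} (\<lambda>s. \<bar>u s\<bar>) \<le> 1/2" .
    have "norm (integral {m..\<tau>} w) \<le> integral {m..\<tau>} (\<lambda>s. \<bar>d m\<bar> * \<bar>u s\<bar>)"
    proof (rule integral_norm_bound_integral)
      show "w integrable_on {m..\<tau>}" using iw m0T by (intro integrable_on_subinterval[OF iw]) auto
      show "(\<lambda>s. \<bar>d m\<bar> * \<bar>u s\<bar>) integrable_on {m..\<tau>}"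
        using m0T by (intro integrable_on_mult_right integrable_on_subinterval[OF iu]) auto
      fix s assume s: "s \<in> {m..\<tau>}"
      have "w s = (gauss (z2 s) - gauss (z1 s)) * u s" by (simp add: w_def rhs_def algebra_simps)
      then have "norm (w s) = \<bar>gauss (z2 s) - gauss (z1 s)\<bar> * \<bar>u s\<bar>" by (simp add: abs_mult)
      also have "\<dots> \<le> \<bar>d m\<bar> * \<bar>u s\<bar>"
        using gauss_lipschitz[of "z2 s" "z1 s"] m(2)[of s] s m(1)
        by (intro mult_right_mono) (auto simp: d_def)
      finally show "norm (w s) \<le> \<bar>d m\<bar> * \<bar>u s\<bar>" .
    qed
    also have "\<dots> = \<bar>d m\<bar> * integral {m..\<tau>} (\<lambda>s. \<bar>u s\<bar>)" by simp
    also have "\<dots> \<le> \<bar>d m\<bar> * (1/2)" using 2 by (intro mult_left_mono) auto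
    finally show ?thesis using 1 by simp
  qed
  then have "\<bar>d m\<bar> = 0" by simp
  then have "d \<sigma> = 0" using m(2)[of \<sigma>] \<sigma> by auto
  then have "\<sigma> \<in> Z" using \<sigma> \<tau>T by (auto simp: Z_def)
  then show False using \<tau>(2) \<sigma> by fastforce
qed

theorem theorem6p3:
  shows
    "(CARD('d::finite) > 1 \<longrightarrow>
        (\<forall>N T. \<forall>x\<^sub>\<alpha> x\<^sub>\<omega> :: nat \<Rightarrow> real ^ 'd.
           N \<ge> 1 \<and> T > 0 \<and> inj_on x\<^sub>\<alpha> {1..N} \<and> inj_on x\<^sub>\<omega> {1..N} \<longrightarrow>
           ensemble_steerable T N x\<^sub>\<alpha> x\<^sub>\<omega>) \<and>
        (\<forall>Q \<in> (Diffc0 :: (real ^ 'd \<Rightarrow> real ^ 'd) set). \<forall>K \<epsilon> T.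
           compact K \<and> \<epsilon> > 0 \<and> T > 0 \<longrightarrow> flow_approximable T K \<epsilon> Q))
     \<and>
     (\<forall>Q \<in> (Diffc0 :: (real \<Rightarrow> real) set). \<forall>K \<epsilon> T.
        compact K \<and> \<epsilon> > 0 \<and> T > 0 \<longrightarrow> flow_approximable T K \<epsilon> Q)
     \<and>
     (\<forall>N. \<forall>x\<^sub>\<alpha> x\<^sub>\<omega> :: nat \<Rightarrow> real.
        N \<ge> 1 \<and> inj_on x\<^sub>\<alpha> {1..N} \<and> inj_on x\<^sub>\<omega> {1..N} \<longrightarrow>
        ((\<exists>T>0. ensemble_steerable T N x\<^sub>\<alpha> x\<^sub>\<omega>) \<longleftrightarrow>
         (\<forall>i\<in>{1..N}. \<forall>j\<in>{1..N}. x\<^sub>\<alpha> i < x\<^sub>\<alpha> j \<longleftrightarrow> x\<^sub>\<omega> i < x\<^sub>\<omega> j)))"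
proof (intro conjI impI allI ballI; (elim conjE)?)
  fix N :: nat and T :: real and x\<^sub>\<alpha> x\<^sub>\<omega> :: "nat \<Rightarrow> real ^ 'd"
  assume "CARD('d) > 1" "T > 0" "inj_on x\<^sub>\<alpha> {1..N}" "inj_on x\<^sub>\<omega> {1..N}"
  then show "ensemble_steerable T N x\<^sub>\<alpha> x\<^sub>\<omega>"
    by (intro ensemble_steerableI steerable_of_dim_ge_2) auto
next
  fix Q :: "real ^ 'd \<Rightarrow> real ^ 'd" and K :: "(real ^ 'd) set" and \<epsilon> T :: real
  assume "Q \<in> Diffc0" "compact K" "\<epsilon> > 0" "T > 0"
  then show "flow_approximable T K \<epsilon> Q" by (rule flow_approximable_Diffc0)
next
  fix Q :: "real \<Rightarrow> real" and K :: "real set" and \<epsilon> T :: real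
  assume "Q \<in> Diffc0" "compact K" "\<epsilon> > 0" "T > 0"
  then show "flow_approximable T K \<epsilon> Q" by (rule flow_approximable_Diffc0)
next
  fix N :: nat and x\<^sub>\<alpha> x\<^sub>\<omega> :: "nat \<Rightarrow> real"
  assume inj: "inj_on x\<^sub>\<alpha> {1..N}" "inj_on x\<^sub>\<omega> {1..N}"
  show "(\<exists>T>0. ensemble_steerable T N x\<^sub>\<alpha> x\<^sub>\<omega>) \<longleftrightarrow>
      (\<forall>i\<in>{1..N}. \<forall>j\<in>{1..N}. x\<^sub>\<alpha> i < x\<^sub>\<alpha> j \<longleftrightarrow> x\<^sub>\<omega> i < x\<^sub>\<omega> j)" (is "?steer \<longleftrightarrow> ?ord")
  proof
    assume ?steer
    then obtain T u v where T: "T > 0" "is_control T u v" and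
      tr: "\<And>k. k \<in> {1..N} \<Longrightarrow> \<exists>z. trajectory T u v (x\<^sub>\<alpha> k) z \<and> z T = x\<^sub>\<omega> k"
      unfolding ensemble_steerable_def by blast
    have mono: "x\<^sub>\<omega> i < x\<^sub>\<omega> j" if "i \<in> {1..N}" "j \<in> {1..N}" "x\<^sub>\<alpha> i < x\<^sub>\<alpha> j" for i j
    proof -
      obtain z1 where z1: "trajectory T u v (x\<^sub>\<alpha> i) z1" "z1 T = x\<^sub>\<omega> i" using tr[OF \<open>i \<in> {1..N}\<close>] by blast
      obtain z2 where z2: "trajectory T u v (x\<^sub>\<alpha> j) z2" "z2 T = x\<^sub>\<omega> j" using tr[OF \<open>j \<in> {1..N}\<close>] by blast
      show ?thesis using trajectories_ordered[OF T(2) z1(1) z2(1) T(1) that(3)] z1(2) z2(2) by simp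
    qed
    show ?ord
    proof (intro ballI iffI)
      fix i j assume i: "i \<in> {1..N}" and j: "j \<in> {1..N}"
      show "x\<^sub>\<omega> i < x\<^sub>\<omega> j" if "x\<^sub>\<alpha> i < x\<^sub>\<alpha> j" using mono[OF i j that] .
      \<comment> \<open>The reversed order is excluded by \<open>mono\<close> for the swapped pair;
        equality would force \<open>i = j\<close> by injectivity.\<close>
      show "x\<^sub>\<alpha> i < x\<^sub>\<alpha> j" if "x\<^sub>\<omega> i < x\<^sub>\<omega> j"
        using mono[OF j i] inj_onD[OF inj(1) _ i j] that
        by (metis order_less_asym order_less_irrefl linorder_less_linear)
    qed
  next
    assume ?ord
    then have "steerable {1..N} x\<^sub>\<alpha> x\<^sub>\<omega>" using inj by (intro steerable_ordered) auto
    then have "ensemble_steerable 1 N x\<^sub>\<alpha> x\<^sub>\<omega>" by (rule ensemble_steerableI) simp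
    then show ?steer using zero_less_one by blast
  qed
qed

end
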